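(* Let $f(z,w)=(p(z),q(z,w))$ be a polynomial skew product on $\mathbb{C}^2$. For any $\gamma\in\Gamma_f$ there exist $\mu$ and $\nu$ in the unit circle $S^1$ such that $$\gamma(z,w)=\bigl(\mu(z-\zeta)+\zeta,\ \nu(w-\zeta_z)+\zeta_{\sigma(z)}\bigr),$$ where $\sigma(z)=\mu(z-\zeta)+\zeta$ belongs to $\Sigma_p$.
   Context: A polynomial skew product on $\mathbb{C}^2$ is a map $f(z,w)=(p(z),q(z,w))$ with $p(z)=a_\delta z^\delta+a_{\delta-1}z^{\delta-1}+\cdots+a_0$ and $q(z,w)=b_d(z)w^d+b_{d-1}(z)w^{d-1}+\cdots+b_0(z)$, where $a_\delta\ne0$, the $b_j$ are polynomials, $b_d\not\equiv0$ has degree $l\ge0$, $\delta\ge2$, $d\ge2$. Write $q_z(w)=q(z,w)$ and $f^n(z,w)=(p^n(z),Q_z^n(w))$, where $Q_z^n=q_{p^{n-1}(z)}\circ\cdots\circ q_{p(z)}\circ q_z$. Let $K_p=\{z:\{p^n(z)\}_{n\ge1}\text{ bounded}\}$ and $J_p=\partial K_p$. For $z\in K_p$ let $G_z(w)=\lim_{n\to\infty}d^{-n}\log^+|Q_z^n(w)|$ (the limit exists) and $K_z=\{w:G_z(w)=0\}$. The Julia set of $f$ is $J_f=\bigcup_{z\in J_p}\{z\}\times\partial K_z$, where $\partial K_z=\emptyset$ if $K_z=\mathbb{C}$. Let $S$ be the set of maps $\gamma(z,w)=(c_1z+c_2,\,c_3w+c_4(z))$ with $|c_1|=|c_3|=1$,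 $c_2\in\mathbb{C}$, and $c_4$ a polynomial. Set $\Gamma_f=\{\gamma\in S:\gamma(J_f)=J_f\}$. $\Sigma_p$ is the group of maps $\sigma(z)=c_1z+c_2$ with $|c_1|=1$ and $\sigma(J_p)=J_p$. The centroids of $f$ are the constant $\zeta=-a_{\delta-1}/(\delta a_\delta)$ and the rational function $\zeta_z=-b_{d-1}(z)/(d\,b_d(z))$ of $z$. The formula for $\gamma$ is an identity of rational maps in $(z,w)$; in particular the rational function $\nu(w-\zeta_z)+\zeta_{\sigma(z)}$ is a polynomial. *)

theory Defs
  imports "HOL-Analysis.Analysis" "HOL-Computational_Algebra.Computational_Algebra"
begin

(* A polynomial q(z,w) is an element of C[z][w]: the outer variable is w, and
   coeff q j is the polynomial b_j in z. *)

definition fiber_poly :: "complex poly poly \<Rightarrow> complex \<Rightarrow> complex poly" where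
  "fiber_poly q z = map_poly (\<lambda>b. poly b z) q"

definition skew_product ::
  "complex poly \<Rightarrow> complex poly poly \<Rightarrow> complex \<times> complex \<Rightarrow> complex \<times> complex" where
  "skew_product p q = (\<lambda>(z, w). (poly p z, poly (fiber_poly q z) w))"

definition fiber_iterate ::
  "complex poly \<Rightarrow> complex poly poly \<Rightarrow> nat \<Rightarrow> complex \<Rightarrow> complex \<Rightarrow> complex" where
  "fiber_iterate p q n z w = snd ((skew_product p q ^^ n) (z, w))"

definition base_filled_Julia :: "complex poly \<Rightarrow> complex set" where
  "base_filled_Julia p = {z. bounded ((\<lambda>n. (poly p ^^ n) z) ` {1..})}"

definition base_Julia :: "complex poly \<Rightarrow> complex set" where
  "base_Julia p = frontier (base_filled_Julia p)"

definition log_plus :: "real \<Rightarrow> real" where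
  "log_plus x = ln (max 1 x)"

(* Meaningful for z in base_filled_Julia p, where the limit exists. *)
definition fiber_Green :: "complex poly \<Rightarrow> complex poly poly \<Rightarrow> complex \<Rightarrow> complex \<Rightarrow> real" where
  "fiber_Green p q z w =
     lim (\<lambda>n. log_plus (norm (fiber_iterate p q n z w)) / real (degree q) ^ n)"

definition fiber_filled_Julia :: "complex poly \<Rightarrow> complex poly poly \<Rightarrow> complex \<Rightarrow> complex set" where
  "fiber_filled_Julia p q z = {w. fiber_Green p q z w = 0}"

definition skew_Julia :: "complex poly \<Rightarrow> complex poly poly \<Rightarrow> (complex \<times> complex) set" where
  "skew_Julia p q = (\<Union>z\<in>base_Julia p. {z} \<times> frontier (fiber_filled_Julia p q z))"

definition symmetry_maps :: "(complex \<times> complex \<Rightarrow> complex \<times> complex) set" where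
  "symmetry_maps = {\<gamma>. \<exists>c1 c2 c3 c4. norm c1 = 1 \<and> norm c3 = 1 \<and>
     \<gamma> = (\<lambda>(z, w). (c1 * z + c2, c3 * w + poly c4 z))}"

definition skew_symmetries ::
  "complex poly \<Rightarrow> complex poly poly \<Rightarrow> (complex \<times> complex \<Rightarrow> complex \<times> complex) set" where
  "skew_symmetries p q = {\<gamma> \<in> symmetry_maps. \<gamma> ` skew_Julia p q = skew_Julia p q}"

definition base_symmetries :: "complex poly \<Rightarrow> (complex \<Rightarrow> complex) set" where
  "base_symmetries p = {\<sigma>. (\<exists>c1 c2. norm c1 = 1 \<and> \<sigma> = (\<lambda>z. c1 * z + c2)) \<and>
     \<sigma> ` base_Julia p = base_Julia p}"

definition base_centroid :: "complex poly \<Rightarrow> complex" where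
  "base_centroid p = - coeff p (degree p - 1) / (of_nat (degree p) * lead_coeff p)"

(* The field C(z,w) of rational functions is the type complex poly poly fract, the
   fraction field of C[z][w]; this is the coordinate function w in it. *)
definition ratfun_w :: "complex poly poly fract" where
  "ratfun_w = to_fract [:0, 1:]"

definition ratfun_const :: "complex \<Rightarrow> complex poly poly fract" where
  "ratfun_const c = to_fract [:[:c:]:]"

(* The rational function - b_{d-1}(s(z)) / (d b_d(s(z))) of z, i.e. the centroid
   \<zeta>_{s(z)} at a nonconstant polynomial s. For s = [:0, 1:] it is \<zeta>_z. If s is
   nonconstant and q is nonzero of positive degree, the denominator is nonzero. *)
definition fiber_centroid :: "complex poly poly \<Rightarrow> complex poly \<Rightarrow> complex poly poly fract" where
  "fiber_centroid q s =
     Fract [:- pcompose (coeff q (degree q - 1)) s:]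
           [:of_nat (degree q) * pcompose (lead_coeff q) s:]"

end

theory Submission
  imports Defs "HOL-Complex_Analysis.Complex_Analysis" "HOL-Real_Asymp.Real_Asymp"
begin

text \<open>
  A plane compact set that is the filled Julia set of a polynomial composition determines the centroid
  of that composition.  Let \<open>Q\<close> have degree \<open>N = d^n\<close> and be moderately bounded on the filled set \<open>K\<close>, let \<open>Q'\<close> and
  \<open>K'\<close> be another such pair, and let the isometry \<open>T w = c w + e\<close> carry \<open>\<partial>K\<close> onto \<open>\<partial>K'\<close>.  The monic
  multiples of \<open>Q\<close> and \<open>Q' \<circ> T\<close> are both, up to a moderate factor, as small on \<open>K\<close> as a monic polynomial
  of degree \<open>N\<close> can be, namely of size \<open>cap(K)^N\<close>.  Their difference has degree at most \<open>N - 1\<close>, and its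
  coefficient there is \<open>N\<close> times the discrepancy between the two centroids.  By the Bernstein-Walsh
  inequality such a coefficient is at most the supremum on \<open>K\<close> times \<open>cap(K)^(1 - N)\<close>.  So \<open>N\<close> times the
  discrepancy is moderate; as \<open>N\<close> grows it must vanish (\<open>centroid_of_frontier_symmetry\<close>).  Applied to
  the constant sequence \<open>p\<close> this fixes the centroid of \<open>p\<close>; applied to the fibers over \<open>z\<close> and \<open>\<sigma> z\<close>
  it gives \<open>c\<^sub>3 \<zeta>\<^sub>z + c\<^sub>4(z) = \<zeta>\<close> at \<open>\<sigma> z\<close>, and infinitely many such \<open>z\<close> give an identity of rational
  functions.

  The difficulty is that the leading coefficient \<open>b\<close> of \<open>q\<close> may vanish on the Julia set of \<open>p\<close>, so the
  fiber dynamics can be tamed only along orbits that do not approach the zeros of \<open>b\<close> too fast, and this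
  is needed simultaneously at \<open>z\<close> and at \<open>\<sigma> z\<close>.  Such \<open>z\<close> are found without constructing the equilibrium
  measure: one averages \<open>ln |b(p^j z)|\<close> over the finite set \<open>p^n(z) = z0\<close> with \<open>z0\<close> outside the filled
  Julia set.  Reciprocity of resultants turns the average into one of \<open>ln |p^n(y) - z0|\<close> over the zeros
  \<open>y\<close> of \<open>b(p^j)\<close>, which is bounded below uniformly in \<open>j\<close>.  Summing over \<open>j\<close> with summable weights, some point
  of the finite set is no worse than average, and compactness as \<open>n\<close> grows gives \<open>generic_point\<close>.

  Invariance of the base Julia set under \<open>\<sigma>\<close> holds because \<open>\<sigma>\<close> preserves the projection of the Julia set
  of \<open>f\<close>, which is dense in the base Julia set by a Montel argument:
  near every point of the base Julia set some iterate of \<open>p\<close> attains one of two prescribed generic values.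
\<close>

section \<open>Resultants and polynomial lemniscates\<close>

lemma poly_eq_prod_proots:
  fixes P :: "complex poly"
  shows "poly P x = lead_coeff P * (\<Prod>y\<in>#proots P. x - y)"
proof -
  have "poly (\<Prod>y\<in>#A. [:- y, 1:]) x = (\<Prod>y\<in>#A. x - y)" for A :: "complex multiset"
    by (induction A) (auto simp: algebra_simps)
  then show ?thesis
    by (metis complex_poly_decompose_multiset poly_smult)
qed

lemma norm_prod_mset: "norm (\<Prod>y\<in>#A. g y) = (\<Prod>y\<in>#A. norm (g y :: complex))"
  by (induction A) (auto simp: norm_mult)

lemma prod_mset_const_mult: "(\<Prod>y\<in>#A. c * g y) = (c::real) ^ size A * (\<Prod>y\<in>#A. g y)"
  by (induction A) (auto simp: algebra_simps)

lemma prod_mset_swap: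
  "(\<Prod>x\<in>#A. \<Prod>y\<in>#B. g x y) = (\<Prod>y\<in>#B. \<Prod>x\<in>#A. (g x y :: real))"
  by (induction A) (auto simp: prod_mset.distrib)

lemma prod_mset_bounds:
  "(\<And>x. x \<in># A \<Longrightarrow> 0 \<le> g x \<and> g x \<le> (M::real)) \<Longrightarrow>
     0 \<le> (\<Prod>x\<in>#A. g x) \<and> (\<Prod>x\<in>#A. g x) \<le> M ^ size A"
proof (induction A)
  case (add x A)
  then have "0 \<le> g x" "g x \<le> M" "0 \<le> (\<Prod>x\<in>#A. g x)" "(\<Prod>x\<in>#A. g x) \<le> M ^ size A"
    by auto
  then show ?case by (auto intro!: mult_mono)
qed auto

lemma prod_mset_ge_1:
  "(\<And>x. x \<in># A \<Longrightarrow> 1 \<le> (g x :: real)) \<Longrightarrow> 1 \<le> (\<Prod>x\<in>#A. g x)"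
proof (induction A)
  case (add x A)
  then have "1 \<le> g x" "1 \<le> (\<Prod>x\<in>#A. g x)"
    by auto
  then have "1 * 1 \<le> g x * (\<Prod>x\<in>#A. g x)"
    by (intro mult_mono) auto
  then show ?case by simp
qed auto

lemma sum_mset_ge_const:
  "(\<And>x. x \<in># A \<Longrightarrow> (c::real) \<le> g x) \<Longrightarrow> real (size A) * c \<le> (\<Sum>x\<in>#A. g x)"
proof (induction A)
  case (add x A)
  then have "c \<le> g x" "real (size A) * c \<le> (\<Sum>x\<in>#A. g x)"
    by auto
  then show ?case by (simp add: algebra_simps)
qed auto

lemma ln_prod_mset:
  "(\<And>z. z \<in># A \<Longrightarrow> g z > 0) \<Longrightarrow>
     ln (\<Prod>z\<in>#A. g z) = (\<Sum>z\<in>#A. ln (g z :: real)) \<and> (\<Prod>z\<in>#A. g z) > 0"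
proof (induction A)
  case (add x A)
  then have "g x > 0" "ln (\<Prod>z\<in>#A. g z) = (\<Sum>z\<in>#A. ln (g z))" "(\<Prod>z\<in>#A. g z) > 0"
    by auto
  then show ?case by (simp only: image_mset_add_mset prod_mset.add_mset sum_mset.add_mset ln_mult_pos mult_pos_pos)
qed auto

lemma degree_sub_const: "degree P > 0 \<Longrightarrow> degree (P - [:a:]) = degree P"
  and lead_coeff_sub_const: "degree P > 0 \<Longrightarrow> lead_coeff (P - [:a:]) = lead_coeff P"
  for P :: "complex poly"
proof -
  assume P: "degree P > 0"
  have "degree (P + [:-a:]) = degree P"
    using P by (intro degree_add_eq_left) auto
  also have "P + [:-a:] = P - [:a:]"
    by (simp add: poly_eq_iff coeff_pCons split: nat.splits)
  finally show deg: "degree (P - [:a:]) = degree P" .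
  show "lead_coeff (P - [:a:]) = lead_coeff P"
    using P unfolding deg by (auto simp: coeff_pCons split: nat.splits)
qed

text \<open>
  Both sides are the absolute value of the resultant of \<open>P\<close> and \<open>Q\<close>.  Everything quantitative below, the
  capacity estimate as well as the averages over preimages, comes from this identity.
\<close>

lemma resultant_reciprocity:
  fixes P Q :: "complex poly"
  shows "norm (lead_coeff Q) ^ degree P * (\<Prod>w\<in>#proots Q. norm (poly P w)) =
         norm (lead_coeff P) ^ degree Q * (\<Prod>y\<in>#proots P. norm (poly Q y))"
proof -
  have *: "(\<Prod>w\<in>#proots Q. norm (poly P w)) = norm (lead_coeff P) ^ degree Q *
     (\<Prod>w\<in>#proots Q. \<Prod>y\<in>#proots P. norm (w - y))" for P Q :: "complex poly"
    by (subst poly_eq_prod_proots)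
       (simp add: norm_mult norm_prod_mset prod_mset_const_mult size_proots_complex)
  show ?thesis
    unfolding *[of P Q] *[of Q P]
    by (subst prod_mset_swap) (simp add: norm_minus_commute)
qed

lemma holomorphic_on_poly: "poly (P :: complex poly) holomorphic_on A"
  unfolding holomorphic_on_def field_differentiable_def
  by (blast intro: has_field_derivative_at_within poly_DERIV)

lemma norm_poly_le_of_frontier:
  fixes P :: "complex poly"
  assumes "compact S" "\<And>w. w \<in> frontier S \<Longrightarrow> norm (poly P w) \<le> M" "w \<in> S"
  shows "norm (poly P w) \<le> M"
proof (rule maximum_modulus_frontier[where S = S and f = "poly P"])
  show "poly P holomorphic_on interior S"
    by (rule holomorphic_on_poly)
  show "continuous_on (closure S) (poly P)"
    by (intro continuous_intros)
qed (use assms in \<open>auto simp: compact_imp_bounded\<close>)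

text \<open>
  The maximum principle for the reversed polynomial, whose value at 0 is the leading coefficient.
\<close>

lemma exists_on_circle_norm_ge_lead_coeff:
  fixes P :: "complex poly"
  assumes "r > 0"
  shows "\<exists>c. norm c = r \<and> norm (lead_coeff P) * r ^ degree P \<le> norm (poly P c)"
proof (rule ccontr)
  assume neg: "\<not> ?thesis"
  have "continuous_on (sphere 0 (1/r)) (\<lambda>t. norm (poly (reflect_poly P) t))"
    by (intro continuous_intros)
  moreover have "sphere (0::complex) (1/r) \<noteq> {}"
    using assms by simp
  ultimately obtain t0 where t0: "t0 \<in> sphere 0 (1/r)"
    and max: "\<forall>t \<in> sphere 0 (1/r). norm (poly (reflect_poly P) t) \<le> norm (poly (reflect_poly P) t0)"
    using continuous_attains_sup[OF compact_sphere] by blast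
  have nt0: "norm t0 = 1 / r"
    using t0 by simp
  have "norm (poly (reflect_poly P) 0) \<le> norm (poly (reflect_poly P) t0)"
  proof (rule norm_poly_le_of_frontier[of "cball 0 (1/r)"])
    show "norm (poly (reflect_poly P) w) \<le> norm (poly (reflect_poly P) t0)"
      if "w \<in> frontier (cball 0 (1/r))" for w
      using that max assms by (simp add: frontier_cball)
  qed (use assms in auto)
  also have "poly (reflect_poly P) t0 = t0 ^ degree P * poly P (inverse t0)"
    using nt0 assms by (intro poly_reflect_poly_nz) auto
  also have "norm \<dots> = norm (poly P (inverse t0)) / r ^ degree P"
    using nt0 by (simp add: norm_mult norm_power power_divide)
  finally have "norm (lead_coeff P) * r ^ degree P \<le> norm (poly P (inverse t0))"
    using assms by (simp add: field_simps)
  moreover have "norm (inverse t0) = r"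
    using nt0 by (simp add: norm_inverse)
  ultimately show False using neg by blast
qed

lemma lead_coeff_prod_linear_mset:
  "lead_coeff (\<Prod>y\<in>#A. [:- g y, 1:]) = (1::complex)" "degree (\<Prod>y\<in>#A. [:- g y, 1:] :: complex poly) = size A"
proof -
  have *: "lead_coeff (\<Prod>y\<in>#A. [:- g y, 1:]) = (1::complex)"
    by (induction A) (auto simp: lead_coeff_mult simp del: mult_pCons_left)
  then show "lead_coeff (\<Prod>y\<in>#A. [:- g y, 1:]) = (1::complex)" .
  show "degree (\<Prod>y\<in>#A. [:- g y, 1:] :: complex poly) = size A"
  proof (induction A)
    case (add x A)
    have "(\<Prod>y\<in>#A. [:- g y, 1:] :: complex poly) \<noteq> 0"
      by (auto simp: prod_mset_zero_iff)
    then show ?case using add by (simp add: degree_mult_eq del: mult_pCons_left)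
  qed auto
qed

text \<open>
  This is the Bernstein-Walsh inequality at infinity for the set \<open>{|Q| \<le> r}\<close>, whose capacity is
  \<open>(r / |lead_coeff Q|) powr (1 / degree Q)\<close>.  Instead of a maximum principle in the exterior domain the proof
  uses the product of \<open>P\<close> over one level set \<open>Q = c\<close>: by reciprocity it is, up to leading coefficients,
  the value at \<open>c\<close> of the monic polynomial with roots \<open>Q(y)\<close>, where \<open>y\<close> runs over the zeros of \<open>P\<close>,
  and on the circle \<open>|c| = r\<close> that polynomial somewhere reaches \<open>r ^ degree P\<close>.
\<close>

lemma lead_coeff_bound_on_lemniscate:
  fixes P Q :: "complex poly"
  assumes "degree Q > 0" "r > 0" "M \<ge> 0"
    and le: "\<And>w. norm (poly Q w) = r \<Longrightarrow> norm (poly P w) \<le> M"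
  shows "norm (lead_coeff P) ^ degree Q * r ^ degree P \<le> M ^ degree Q * norm (lead_coeff Q) ^ degree P"
proof -
  define S where "S = (\<Prod>y\<in>#proots P. [:- poly Q y, 1:])"
  have "lead_coeff S = 1" "degree S = degree P"
    unfolding S_def lead_coeff_prod_linear_mset(1) by (simp_all add: lead_coeff_prod_linear_mset(2) size_proots_complex)
  then obtain c where c: "norm c = r" and ge: "r ^ degree P \<le> norm (poly S c)"
    using exists_on_circle_norm_ge_lead_coeff[OF assms(2), of S] by auto
  define Q' where "Q' = Q - [:c:]"
  have deg: "degree Q' = degree Q" and lead: "lead_coeff Q' = lead_coeff Q"
    unfolding Q'_def using assms(1) by (rule degree_sub_const, rule lead_coeff_sub_const)
  have Q'0: "Q' \<noteq> 0" using deg assms(1) by auto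
  have "poly S c = (\<Prod>y\<in>#proots P. c - poly Q y)"
    unfolding S_def by (simp add: poly_prod_mset)
  then have S: "norm (poly S c) = (\<Prod>y\<in>#proots P. norm (poly Q' y))"
    by (simp add: norm_prod_mset Q'_def norm_minus_commute)
  have "norm (lead_coeff P) ^ degree Q * r ^ degree P \<le>
        norm (lead_coeff P) ^ degree Q' * (\<Prod>y\<in>#proots P. norm (poly Q' y))"
    using ge S deg by (intro mult_mono) (auto simp: assms(2) less_imp_le)
  also have "\<dots> = norm (lead_coeff Q') ^ degree P * (\<Prod>w\<in>#proots Q'. norm (poly P w))"
    by (rule resultant_reciprocity [symmetric])
  also have "(\<Prod>w\<in>#proots Q'. norm (poly P w)) \<le> M ^ size (proots Q')"
  proof -
    have "norm (poly P w) \<le> M" if "w \<in># proots Q'" for w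
      using that Q'0 c by (intro le) (auto simp: Q'_def)
    then show ?thesis
      using prod_mset_bounds[of "proots Q'" "\<lambda>w. norm (poly P w)" M] by simp
  qed
  also have "size (proots Q') = degree Q"
    by (simp add: size_proots_complex deg)
  finally show ?thesis using lead by (simp add: mult.commute mult_right_mono)
qed



section \<open>Centroids under composition\<close>

definition centroid :: "complex poly \<Rightarrow> complex" where
  "centroid P = - coeff P (degree P - 1) / (of_nat (degree P) * lead_coeff P)"

text \<open>
  The sum of the roots with multiplicity.  Reading it off the reversed polynomial makes it
  additive under products, since only the two lowest coefficients are involved.
\<close>

definition root_sum :: "complex poly \<Rightarrow> complex" where
  "root_sum P = - coeff (reflect_poly P) 1 / coeff (reflect_poly P) 0"

lemma coeff_reflect_poly_1:
  fixes P :: "complex poly"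
  assumes "degree P \<ge> 1"
  shows "coeff (reflect_poly P) 1 = coeff P (degree P - 1)"
  using assms by (simp only: coeff_reflect_poly not_less[symmetric] if_False)

lemma root_sum_eq: "degree P \<ge> 1 \<Longrightarrow> root_sum P = of_nat (degree P) * centroid P"
  unfolding root_sum_def centroid_def using coeff_reflect_poly_1[of P] by auto

lemma root_sum_mult:
  assumes "P \<noteq> 0" "Q \<noteq> 0"
  shows "root_sum (P * Q) = root_sum P + root_sum Q"
proof -
  have "coeff (A * B) (Suc 0) = coeff A 0 * coeff B 1 + coeff A 1 * coeff B 0" for A B :: "complex poly"
    by (simp add: coeff_mult atMost_Suc)
  then show ?thesis using assms
    by (simp add: root_sum_def reflect_poly_mult coeff_mult_0 diff_divide_distrib minus_divide_left[symmetric] flip: One_nat_def)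
qed

lemma root_sum_add_const:
  assumes "degree P \<ge> 2"
  shows "root_sum ([:a:] + P) = root_sum P"
proof -
  have d: "degree ([:a:] + P) = degree P" using assms by (intro degree_add_eq_right) auto
  have "coeff ([:a:] + P) k = coeff P k" if "k \<ge> 1" for k
    using that by (auto simp: coeff_pCons split: nat.splits)
  then show ?thesis
    using assms d by (simp add: root_sum_def coeff_reflect_poly_1[unfolded One_nat_def])
qed

text \<open>
  Adding a constant to a polynomial of degree at least 2 leaves its two leading coefficients alone, so in
  Horner's scheme for \<open>P \<circ> Q\<close> every multiplication by \<open>Q\<close> contributes one copy of the root sum of \<open>Q\<close>.
\<close>

lemma root_sum_pcompose:
  assumes "P \<noteq> 0" "degree Q \<ge> 2"
  shows "root_sum (pcompose P Q) = of_nat (degree P) * root_sum Q"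
  using assms(1)
proof (induction P)
  case (pCons a P)
  show ?case
  proof (cases "P = 0")
    case True
    then show ?thesis using pCons by (simp add: root_sum_def coeff_reflect_poly)
  next
    case False
    have nz: "pcompose P Q \<noteq> 0" "Q \<noteq> 0" using False assms(2) by (auto simp: pcompose_eq_0_iff)
    then have "degree (Q * pcompose P Q) \<ge> 2" using assms(2) by (simp add: degree_mult_eq)
    then have "root_sum (pcompose (pCons a P) Q) = root_sum Q + root_sum (pcompose P Q)"
      using nz by (simp add: pcompose_pCons root_sum_add_const root_sum_mult)
    then show ?thesis using False pCons by (simp add: algebra_simps)
  qed
qed auto

text \<open>
  Postcomposition does not move the centroid; hence all iterates along an orbit share the centroid of
  the innermost polynomial.
\<close>

lemma centroid_pcompose:
  assumes "degree P \<ge> 1" "degree Q \<ge> 2"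
  shows "centroid (pcompose P Q) = centroid Q"
proof -
  have d: "degree (pcompose P Q) = degree P * degree Q" by (rule degree_pcompose)
  then have d1: "degree (pcompose P Q) \<ge> 1" using assms by simp
  have "of_nat (degree P * degree Q) * centroid (pcompose P Q) = root_sum (pcompose P Q)"
    using root_sum_eq[OF d1] unfolding d by simp
  also have "\<dots> = of_nat (degree P) * root_sum Q"
    using assms by (intro root_sum_pcompose) auto
  also have "\<dots> = of_nat (degree P * degree Q) * centroid Q"
    using assms by (simp add: root_sum_eq)
  finally show ?thesis using assms by (subst (asm) mult_cancel_left) auto
qed

lemma root_sum_smult: "a \<noteq> 0 \<Longrightarrow> root_sum (smult a P) = root_sum P"
  by (simp add: root_sum_def reflect_poly_smult)

lemma root_sum_eq_sum_proots:
  assumes "P \<noteq> 0"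
  shows "root_sum P = (\<Sum>y\<in>#proots P. y)"
proof -
  have *: "root_sum (\<Prod>y\<in>#A. [:- y, 1:]) = (\<Sum>y\<in>#A. y) \<and> (\<Prod>y\<in>#A. [:- y, 1:]) \<noteq> (0::complex poly)" for A
  proof (induction A)
    case (add x A)
    have "root_sum [:-x, 1:] = x" by (simp add: root_sum_def coeff_reflect_poly)
    then show ?case using add by (simp add: root_sum_mult del: mult_pCons_left)
  qed (simp add: root_sum_def)
  have "root_sum P = root_sum (smult (lead_coeff P) (\<Prod>y\<in>#proots P. [:- y, 1:]))"
    by (simp only: complex_poly_decompose_multiset)
  also have "\<dots> = root_sum (\<Prod>y\<in>#proots P. [:- y, 1:])"
    using assms by (intro root_sum_smult) auto
  also have "\<dots> = (\<Sum>y\<in>#proots P. y)"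
    using * by (rule conjunct1)
  finally show ?thesis .
qed

lemma root_sum_pcompose_linear:
  assumes "P \<noteq> 0" "c \<noteq> 0"
  shows "root_sum (pcompose P [:e, c:]) = (root_sum P - of_nat (degree P) * e) / c"
proof -
  have *: "root_sum (pcompose (\<Prod>y\<in>#A. [:- y, 1:]) [:e, c:]) = (\<Sum>y\<in>#A. (y - e) / c)
        \<and> pcompose (\<Prod>y\<in>#A. [:- y, 1:]) [:e, c:] \<noteq> 0" for A
  proof (induction A)
    case (add x A)
    have l: "pcompose [:- x, 1:] [:e, c:] = [:e - x, c:]" by (simp add: pcompose_pCons)
    have "root_sum [:e - x, c:] = (x - e) / c"
      using assms by (simp add: root_sum_def coeff_reflect_poly minus_divide_left)
    moreover have "[:e - x, c:] \<noteq> 0" using assms by simp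
    ultimately show ?case using add
      by (simp add: pcompose_mult l root_sum_mult del: mult_pCons_left)
  qed (simp add: root_sum_def pcompose_1)
  have "root_sum (pcompose P [:e, c:]) =
        root_sum (pcompose (smult (lead_coeff P) (\<Prod>y\<in>#proots P. [:- y, 1:])) [:e, c:])"
    by (simp only: complex_poly_decompose_multiset)
  also have "\<dots> = (\<Sum>y\<in>#proots P. (y - e) / c)"
    unfolding pcompose_smult using assms *[of "proots P"] root_sum_smult[of "lead_coeff P"] by auto
  also have "\<dots> = ((\<Sum>y\<in>#proots P. y) - of_nat (size (proots P)) * e) / c"
  proof -
    have "(\<Sum>y\<in>#A. (y - e) / c) = ((\<Sum>y\<in>#A. y) - of_nat (size A) * e) / c" for A
      by (induction A) (auto simp: field_simps assms)
    then show ?thesis .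
  qed
  finally show ?thesis
    using assms by (simp add: root_sum_eq_sum_proots size_proots_complex)
qed

lemma centroid_pcompose_linear:
  assumes "degree P \<ge> 1" "c \<noteq> 0"
  shows "centroid (pcompose P [:e, c:]) = (centroid P - e) / c"
proof -
  have d: "degree (pcompose P [:e, c:]) = degree P" using assms by (simp add: degree_pcompose)
  have "of_nat (degree P) * centroid (pcompose P [:e, c:]) = root_sum (pcompose P [:e, c:])"
    using assms d by (simp add: root_sum_eq)
  also have "\<dots> = (root_sum P - of_nat (degree P) * e) / c"
    using assms by (intro root_sum_pcompose_linear) auto
  also have "\<dots> = of_nat (degree P) * ((centroid P - e) / c)"
    using assms by (simp add: root_sum_eq algebra_simps diff_divide_distrib)
  finally show ?thesis using assms(1) by (subst (asm) mult_cancel_left) auto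
qed

section \<open>Nonautonomous polynomial dynamics\<close>

lemma less_ln_iff: "x > 0 \<Longrightarrow> a < ln x \<longleftrightarrow> exp a < (x::real)"
  by (metis exp_less_cancel_iff exp_ln)

lemma ln_le_iff_le_exp: "x > 0 \<Longrightarrow> ln x \<le> a \<longleftrightarrow> (x::real) \<le> exp a"
  by (metis exp_le_cancel_iff exp_ln)

lemma compact_poly_sublevel:
  fixes P :: "complex poly"
  assumes "degree P > 0"
  shows "compact {w. norm (poly P w) \<le> r}"
proof -
  have "filterlim (poly P) at_infinity at_infinity"
    using assms by (rule filterlim_poly_at_infinity)
  then have "eventually (\<lambda>w. max r 0 + 1 \<le> norm (poly P w)) at_infinity"
    unfolding filterlim_at_infinity[OF order_refl] by (auto dest: spec[of _ "max r 0 + 1"])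
  then obtain b where b: "\<And>w. b \<le> norm w \<Longrightarrow> max r 0 + 1 \<le> norm (poly P w)"
    unfolding eventually_at_infinity by blast
  have "norm w \<le> b" if "norm (poly P w) \<le> r" for w
    using b[of w] that by linarith
  then have "bounded {w. norm (poly P w) \<le> r}"
    by (auto simp: bounded_iff)
  moreover have "closed {w. norm (poly P w) \<le> r}"
    by (intro closed_Collect_le continuous_intros)
  ultimately show ?thesis
    by (simp add: compact_eq_bounded_closed)
qed

lemma eventually_subset_of_compact_Inter:
  fixes V :: "nat \<Rightarrow> 'a::heine_borel set"
  assumes "\<And>n. compact (V n)" "decseq V" "(\<Inter>n. V n) \<subseteq> U" "open U"
  shows "\<exists>N. \<forall>n\<ge>N. V n \<subseteq> U"
proof -
  have "\<exists>N. V N - U = {}"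
  proof (rule ccontr)
    assume "\<nexists>N. V N - U = {}"
    then have "(\<Inter>n. V n - U) \<noteq> {}"
    proof (intro compact_nest)
      show "V n - U \<subseteq> V m - U" if "m \<le> n" for m n
        using that assms(2) unfolding decseq_def by blast
    qed (use assms \<open>\<nexists>N. V N - U = {}\<close> in \<open>auto simp: compact_diff\<close>)
    then show False using assms(3) by blast
  qed
  then show ?thesis using assms(2) unfolding decseq_def by blast
qed

fun orbit_poly :: "(nat \<Rightarrow> complex poly) \<Rightarrow> nat \<Rightarrow> complex poly" where
  "orbit_poly f 0 = [:0, 1:]"
| "orbit_poly f (Suc n) = pcompose (f n) (orbit_poly f n)"

text \<open>
  The filled Julia set of the sequence, as the zero set of its Green function.
\<close>

definition null_Green_set :: "(nat \<Rightarrow> complex poly) \<Rightarrow> nat \<Rightarrow> complex set" where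
  "null_Green_set f d =
     {w. (\<lambda>n. log_plus (norm (poly (orbit_poly f n) w)) / real d ^ n) \<longlonglongrightarrow> 0}"

lemma orbit_poly_add:
  "orbit_poly f (n + k) = pcompose (orbit_poly (\<lambda>j. f (n + j)) k) (orbit_poly f n)"
  by (induction k) (simp_all add: pcompose_assoc pcompose_pCons)

lemma orbit_poly_mem_null_Green_set:
  assumes "w \<in> null_Green_set f d" "d > 0"
  shows "poly (orbit_poly f n) w \<in> null_Green_set (\<lambda>j. f (n + j)) d"
proof -
  have "(\<lambda>k. real d ^ n * (log_plus (norm (poly (orbit_poly f (k + n)) w)) / real d ^ (k + n))) \<longlonglongrightarrow> real d ^ n * 0"
    using assms(1) unfolding null_Green_set_def
    by (intro tendsto_mult tendsto_const LIMSEQ_ignore_initial_segment) simp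
  moreover have "real d ^ n * (log_plus (norm (poly (orbit_poly f (k + n)) w)) / real d ^ (k + n)) =
      log_plus (norm (poly (orbit_poly (\<lambda>j. f (n + j)) k) (poly (orbit_poly f n) w))) / real d ^ k" for k
    using assms(2) unfolding add.commute[of k n] orbit_poly_add
    by (simp add: poly_pcompose power_add)
  ultimately show ?thesis
    by (simp add: null_Green_set_def)
qed

text \<open>
  Leading coefficients may tend to 0, but only as fast as \<open>exp (- C (3/2)^n)\<close>.  Any base in the open interval
  from 1 to 2 would do: below \<open>d\<close> it keeps \<open>\<Sum> ln |lead_coeff (f n)| / d^(n + 1)\<close> convergent, and above 1
  it lets the weights of the averaging argument be summable.
\<close>

locale tempered_sequence =
  fixes f :: "nat \<Rightarrow> complex poly" and d :: nat and C :: real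
  assumes d_ge_2: "d \<ge> 2"
    and degree_f: "\<And>n. degree (f n) = d"
    and C_ge_1: "C \<ge> 1"
    and coeff_sum_le: "\<And>n. (\<Sum>i\<le>d. norm (coeff (f n) i)) \<le> exp C"
    and lead_ge: "\<And>n. exp (- (C * (3/2) ^ n)) \<le> norm (lead_coeff (f n))"
begin

abbreviation "Q \<equiv> orbit_poly f"
abbreviation "K \<equiv> null_Green_set f d"

text \<open>
  The logarithm of an escape radius at time \<open>n\<close>.  The radius has to grow with \<open>n\<close> to beat the decay of the
  leading coefficients; the constant is chosen such that \<open>2 escape_log n - (C + 1) (3/2)^n = escape_log (n + 1)\<close>.
\<close>

definition escape_log :: "nat \<Rightarrow> real" where
  "escape_log n = 2 * (C + 1) * (3/2) ^ n"

lemma escape_log_pos: "escape_log n > 0"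
  using C_ge_1 by (simp add: escape_log_def)

lemma degree_Q: "degree (Q n) = d ^ n"
  by (induction n) (simp_all add: degree_pcompose degree_f)

lemma degree_Q_pos: "degree (Q n) > 0"
  using d_ge_2 by (simp add: degree_Q)

lemma norm_lead_le: "norm (lead_coeff (f n)) \<le> exp C"
proof -
  have "norm (coeff (f n) d) \<le> (\<Sum>i\<le>d. norm (coeff (f n) i))"
    by (intro member_le_sum) auto
  then show ?thesis using coeff_sum_le[of n] degree_f[of n] by simp
qed

lemma norm_lead_pos: "norm (lead_coeff (f n)) > 0"
  using lead_ge[of n] exp_gt_zero by (rule less_le_trans[rotated])

lemma ln_norm_step_ge:
  assumes "ln (norm w) > escape_log n" "w \<noteq> 0"
  shows "poly (f n) w \<noteq> 0"
    and "ln (norm (poly (f n) w)) \<ge> d * ln (norm w) - (C + 1) * (3/2) ^ n"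
proof -
  define t where "t = (3/2::real) ^ n"
  define a where "a = norm (lead_coeff (f n))"
  have t: "t \<ge> 1" unfolding t_def by simp
  have a: "a > 0" "a \<ge> exp (- (C * t))" using norm_lead_pos lead_ge by (auto simp: a_def t_def)
  have w: "norm w \<ge> exp (2 * (C + 1) * t)"
    using assms by (simp add: escape_log_def t_def less_ln_iff less_imp_le)
  then have w1: "norm w \<ge> 1"
    using C_ge_1 t by (intro order_trans[OF _ w]) simp
  have "poly (f n) w = (\<Sum>i<d. coeff (f n) i * w ^ i) + lead_coeff (f n) * w ^ d"
    by (subst poly_altdef) (simp add: degree_f lessThan_Suc_atMost[symmetric])
  moreover have "norm (\<Sum>i<d. coeff (f n) i * w ^ i) \<le> exp C * norm w ^ (d - 1)"
  proof -
    have "norm (\<Sum>i<d. coeff (f n) i * w ^ i) \<le> (\<Sum>i<d. norm (coeff (f n) i) * norm w ^ (d - 1))"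
      using w1 by (intro sum_norm_le) (auto simp: norm_mult norm_power intro!: mult_left_mono power_increasing)
    also have "\<dots> = (\<Sum>i<d. norm (coeff (f n) i)) * norm w ^ (d - 1)"
      by (simp add: sum_distrib_right)
    also have "(\<Sum>i<d. norm (coeff (f n) i)) \<le> (\<Sum>i\<le>d. norm (coeff (f n) i))"
      by (intro sum_mono2) auto
    also have "\<dots> \<le> exp C" by (rule coeff_sum_le)
    finally show ?thesis by (simp add: mult_right_mono)
  qed
  ultimately have ge: "norm (poly (f n) w) \<ge> a * norm w ^ d - exp C * norm w ^ (d - 1)"
    unfolding a_def
    by (metis (no_types, lifting) add.commute diff_left_mono norm_diff_ineq norm_mult norm_power order_trans)
  have "2 * exp C \<le> a * norm w"
  proof -
    have "2 * exp C \<le> exp 1 * exp C"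
      using exp_ge_add_one_self[of 1] by (intro mult_right_mono) auto
    also have "\<dots> \<le> exp (- (C * t)) * exp (2 * (C + 1) * t)"
    proof -
      have "C * 1 \<le> C * t" using C_ge_1 t by (intro mult_left_mono) auto
      then have "1 + C \<le> - (C * t) + 2 * (C + 1) * t"
        unfolding distrib_right distrib_left using t by linarith
      then show ?thesis by (simp only: exp_add[symmetric] exp_le_cancel_iff)
    qed
    also have "\<dots> \<le> a * norm w"
      using a w by (intro mult_mono) auto
    finally show ?thesis .
  qed
  then have "exp C * norm w ^ (d - 1) \<le> (a * norm w / 2) * norm w ^ (d - 1)"
    by (intro mult_right_mono) auto
  also have "\<dots> = a * norm w ^ d / 2"
    using d_ge_2 by (cases d) auto
  finally have ge2: "norm (poly (f n) w) \<ge> a * norm w ^ d / 2"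
    using ge by linarith
  have pos: "a * norm w ^ d / 2 > 0" using a assms(2) by simp
  then show "poly (f n) w \<noteq> 0" using ge2 by auto
  have "ln (norm (poly (f n) w)) \<ge> ln (a * norm w ^ d / 2)"
    using ge2 pos by (intro ln_mono) auto
  moreover have "ln (a * norm w ^ d / 2) = ln a + d * ln (norm w) - ln 2"
    using a assms(2) by (simp add: ln_mult ln_div ln_realpow)
  moreover have "ln a \<ge> - (C * t)"
    using a by (simp add: ln_ge_iff)
  moreover have "ln 2 \<le> t"
    using t ln_2_less_1 by linarith
  ultimately show "ln (norm (poly (f n) w)) \<ge> d * ln (norm w) - (C + 1) * (3/2) ^ n"
    unfolding t_def[symmetric] by (simp add: algebra_simps)
qed

text \<open>
  Beyond the escape radius the excess of \<open>ln |Q n w|\<close> over \<open>escape_log n\<close> is multiplied by at least \<open>d\<close>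
  at each step, so the Green function is positive there.
\<close>

lemma escape:
  assumes "norm (poly (Q j) w) > exp (escape_log j)" "n \<ge> j"
  shows "norm (poly (Q n) w) > exp (escape_log n) \<and>
    ln (norm (poly (Q n) w)) - escape_log n \<ge> real d ^ (n - j) * (ln (norm (poly (Q j) w)) - escape_log j)"
  using assms(2)
proof (induction n rule: dec_induct)
  case base
  then show ?case using assms(1) by simp
next
  case (step n)
  define c where "c = ln (norm (poly (Q j) w)) - escape_log j"
  define x where "x = ln (norm (poly (Q n) w))"
  have "norm (poly (Q j) w) > 0" using assms(1) by (meson exp_gt_zero less_trans)
  then have c: "c > 0" using assms(1) unfolding c_def by (simp add: less_ln_iff)
  have nz: "poly (Q n) w \<noteq> 0" using step.IH by (metis exp_gt_zero less_trans norm_eq_zero less_irrefl)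
  then have x: "x > escape_log n" using step.IH unfolding x_def by (simp add: less_ln_iff)
  note s = ln_norm_step_ge[of n "poly (Q n) w", OF x[unfolded x_def] nz]
  have "real d * escape_log n - (C + 1) * (3/2) ^ n \<ge> escape_log (Suc n)"
  proof -
    have "real d * escape_log n \<ge> 2 * escape_log n"
      using d_ge_2 escape_log_pos[of n] by (intro mult_right_mono) auto
    moreover have "2 * escape_log n - (C + 1) * (3/2) ^ n = escape_log (Suc n)"
      by (simp add: escape_log_def algebra_simps)
    ultimately show ?thesis by linarith
  qed
  then have "ln (norm (poly (Q (Suc n)) w)) - escape_log (Suc n) \<ge> real d * (x - escape_log n)"
    using s(2) by (simp add: poly_pcompose x_def algebra_simps)
  moreover have "real d * (x - escape_log n) \<ge> real d * (real d ^ (n - j) * c)"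
    using step.IH unfolding x_def c_def by (intro mult_left_mono) auto
  moreover have "real d * (real d ^ (n - j) * c) = real d ^ (Suc n - j) * c"
    using step.hyps by (simp add: Suc_diff_le)
  ultimately have "ln (norm (poly (Q (Suc n)) w)) - escape_log (Suc n) \<ge> real d ^ (Suc n - j) * c"
    by linarith
  moreover have "real d ^ (Suc n - j) * c > 0" using c d_ge_2 by simp
  ultimately have "ln (norm (poly (Q (Suc n)) w)) > escape_log (Suc n)" by linarith
  then have "norm (poly (Q (Suc n)) w) > exp (escape_log (Suc n))"
    using s(1) by (simp add: less_ln_iff poly_pcompose)
  then show ?case using \<open>ln _ - _ \<ge> real d ^ (Suc n - j) * c\<close> by (simp add: c_def)
qed

lemma log_plus_liminf_pos:
  assumes "norm (poly (Q j) w) > exp (escape_log j)"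
  shows "\<exists>c>0. \<forall>n\<ge>j. c \<le> log_plus (norm (poly (Q n) w)) / real d ^ n"
proof (intro exI conjI allI impI)
  let ?c = "ln (norm (poly (Q j) w)) - escape_log j"
  have "norm (poly (Q j) w) > 0" using assms(1) by (meson exp_gt_zero less_trans)
  then show "?c / real d ^ j > 0" using assms d_ge_2 by (simp add: less_ln_iff)
  fix n assume n: "n \<ge> j"
  note e = escape[OF assms n]
  have "norm (poly (Q n) w) > 0" using e by (meson exp_gt_zero less_trans)
  then have "ln (norm (poly (Q n) w)) \<le> log_plus (norm (poly (Q n) w))"
    unfolding log_plus_def by (intro ln_mono) auto
  then have "real d ^ (n - j) * ?c \<le> log_plus (norm (poly (Q n) w))"
    using e escape_log_pos[of n] by linarith
  then have "real d ^ (n - j) * ?c / real d ^ n \<le> log_plus (norm (poly (Q n) w)) / real d ^ n"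
    by (intro divide_right_mono) auto
  moreover have "real d ^ (n - j) * ?c / real d ^ n = ?c / real d ^ j"
    using n d_ge_2 by (simp add: power_diff field_simps)
  ultimately show "?c / real d ^ j \<le> log_plus (norm (poly (Q n) w)) / real d ^ n" by simp
qed

definition sublevel :: "nat \<Rightarrow> complex set" where
  "sublevel n = {w. norm (poly (Q n) w) \<le> exp (escape_log n)}"

lemma compact_sublevel: "compact (sublevel n)"
  unfolding sublevel_def by (intro compact_poly_sublevel degree_Q_pos)

lemma decseq_sublevel: "decseq sublevel"
proof (rule decseq_SucI)
  show "sublevel (Suc n) \<subseteq> sublevel n" for n
  proof
    fix w assume "w \<in> sublevel (Suc n)"
    then show "w \<in> sublevel n"
      using escape[of n w "Suc n"] by (force simp: sublevel_def)
  qed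
qed

lemma sublevel_nonempty: "sublevel n \<noteq> {}"
proof -
  obtain w where "poly (Q n) w = 0"
    using degree_Q_pos[of n] Fundamental_Theorem_Algebra.fundamental_theorem_of_algebra[of "Q n"] by (auto simp: constant_degree)
  then have "w \<in> sublevel n" by (simp add: sublevel_def)
  then show ?thesis by blast
qed

text \<open>
  This makes the zero set of the Green function a nested intersection of compact lemniscates:
  an orbit that escapes once has positive Green function, and one that never escapes grows at most
  like \<open>exp (const (3/2)^n)\<close>, whose logarithm is negligible against \<open>d^n\<close>.
\<close>

lemma K_eq_Inter_sublevel: "K = (\<Inter>n. sublevel n)"
proof (intro set_eqI iffI)
  fix w assume w: "w \<in> K"
  show "w \<in> (\<Inter>n. sublevel n)"
  proof (rule ccontr)
    assume "w \<notin> (\<Inter>n. sublevel n)"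
    then obtain j where "norm (poly (Q j) w) > exp (escape_log j)"
      by (auto simp: sublevel_def not_le)
    from log_plus_liminf_pos[OF this] obtain c
      where c: "c > 0" "\<And>n. n \<ge> j \<Longrightarrow> c \<le> log_plus (norm (poly (Q n) w)) / real d ^ n" by blast
    have "c \<le> 0"
      using w unfolding null_Green_set_def mem_Collect_eq
      by (rule LIMSEQ_le_const) (use c(2) in blast)
    then show False using c(1) by simp
  qed
next
  fix w assume w: "w \<in> (\<Inter>n. sublevel n)"
  have le: "log_plus (norm (poly (Q n) w)) / real d ^ n \<le> 2 * (C + 1) * (3/4) ^ n" for n
  proof -
    have "max 1 (norm (poly (Q n) w)) \<le> exp (escape_log n)"
      using w escape_log_pos[of n] by (auto simp: sublevel_def)
    then have "log_plus (norm (poly (Q n) w)) \<le> escape_log n"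
      unfolding log_plus_def by (subst ln_le_iff_le_exp) auto
    then have "log_plus (norm (poly (Q n) w)) / real d ^ n \<le> escape_log n / 2 ^ n"
      using escape_log_pos[of n] d_ge_2 by (intro frac_le power_mono) auto
    also have "\<dots> = 2 * (C + 1) * (3/4) ^ n"
      by (simp add: escape_log_def power_divide flip: power_mult_distrib)
    finally show ?thesis .
  qed
  have "(\<lambda>n. log_plus (norm (poly (Q n) w)) / real d ^ n) \<longlonglongrightarrow> 0"
  proof (rule tendsto_sandwich[OF _ _ tendsto_const])
    show "(\<lambda>n. 2 * (C + 1) * (3/4::real) ^ n) \<longlonglongrightarrow> 0"
      by real_asymp
    show "\<forall>\<^sub>F n in sequentially. 0 \<le> log_plus (norm (poly (Q n) w)) / real d ^ n"
      by (auto simp: log_plus_def)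
  qed (use le in auto)
  then show "w \<in> K" by (simp add: null_Green_set_def)
qed

lemma compact_K: "compact K"
  unfolding K_eq_Inter_sublevel using compact_sublevel by (intro compact_Inter) auto

lemma K_nonempty: "K \<noteq> {}"
  unfolding K_eq_Inter_sublevel using compact_sublevel sublevel_nonempty decseq_sublevel
  by (intro compact_nest) (auto simp: decseq_def)

lemma frontier_K_nonempty: "frontier K \<noteq> {}"
  using compact_K K_nonempty
  by (auto simp: frontier_eq_empty compact_imp_bounded)

lemma norm_le_of_K: "w \<in> K \<Longrightarrow> norm w \<le> exp (2 * (C + 1))"
  by (auto simp: K_eq_Inter_sublevel sublevel_def escape_log_def dest: spec[of _ 0])

text \<open>
  The limit of \<open>- \<kappa> n\<close> is the logarithm of the capacity of \<open>K\<close>.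
\<close>

definition \<kappa> :: "nat \<Rightarrow> real" where
  "\<kappa> n = (\<Sum>j<n. ln (norm (lead_coeff (f j))) / real d ^ Suc j)"

lemma norm_lead_Q: "norm (lead_coeff (Q n)) = exp (real d ^ n * \<kappa> n)"
proof (induction n)
  case (Suc n)
  have "norm (lead_coeff (Q (Suc n))) = norm (lead_coeff (f n)) * norm (lead_coeff (Q n)) ^ d"
    using degree_Q_pos[of n] by (simp add: lead_coeff_comp norm_mult norm_power degree_f)
  also have "norm (lead_coeff (f n)) = exp (ln (norm (lead_coeff (f n))))"
    using norm_lead_pos by simp
  also have "norm (lead_coeff (Q n)) ^ d = exp (real d * (real d ^ n * \<kappa> n))"
    unfolding Suc.IH by (simp add: exp_of_nat_mult)
  finally show ?case using d_ge_2
    by (simp add: \<kappa>_def exp_add[symmetric] field_simps)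
qed (simp add: \<kappa>_def)

lemma \<kappa>_le: "n \<le> k \<Longrightarrow> \<kappa> k \<le> \<kappa> n + C / real d ^ n - C / real d ^ k"
proof (induction k rule: dec_induct)
  case (step k)
  have "ln (norm (lead_coeff (f k))) \<le> C"
    using norm_lead_le[of k] norm_lead_pos[of k] by (simp add: ln_le_iff_le_exp)
  then have "ln (norm (lead_coeff (f k))) / real d ^ Suc k \<le> C / real d ^ Suc k"
    by (intro divide_right_mono) auto
  moreover have "C / real d ^ k \<ge> 2 * (C / real d ^ Suc k)"
  proof -
    have "2 * (C / real d ^ Suc k) \<le> real d * (C / real d ^ Suc k)"
      using d_ge_2 C_ge_1 by (intro mult_right_mono) auto
    then show ?thesis using d_ge_2 by simp
  qed
  ultimately have "ln (norm (lead_coeff (f k))) / real d ^ Suc k + C / real d ^ Suc k \<le> C / real d ^ k"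
    by linarith
  then show ?case using step.IH unfolding \<kappa>_def sum.lessThan_Suc by linarith
qed auto

lemma \<kappa>_ge: "\<kappa> n \<ge> - 2 * C"
proof -
  have "\<kappa> n \<ge> - 2 * C * (1 - (3/4) ^ n)"
  proof (induction n)
    case (Suc n)
    have "ln (norm (lead_coeff (f n))) \<ge> - (C * (3/2) ^ n)"
      using lead_ge[of n] norm_lead_pos[of n] by (simp add: ln_ge_iff)
    then have "ln (norm (lead_coeff (f n))) / real d ^ Suc n \<ge> - (C * (3/2) ^ n) / real d ^ Suc n"
      by (intro divide_right_mono) auto
    moreover have "C * (3/2) ^ n / real d ^ Suc n \<le> C * (3/2) ^ n / 2 ^ Suc n"
      using d_ge_2 C_ge_1 by (intro divide_left_mono power_mono) auto
    moreover have "C * (3/2) ^ n / 2 ^ Suc n = C * (3/4) ^ n / 2"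
      by (simp add: power_divide flip: power_mult_distrib)
    ultimately have "ln (norm (lead_coeff (f n))) / real d ^ Suc n \<ge> - (C * (3/4) ^ n / 2)"
      by linarith
    then show ?case using Suc by (simp add: \<kappa>_def algebra_simps)
  qed (simp add: \<kappa>_def)
  moreover have "- 2 * C * (1 - (3/4) ^ n) \<ge> - 2 * C"
    using C_ge_1 by (simp add: algebra_simps)
  ultimately show ?thesis by linarith
qed

text \<open>
  The capacity estimate for \<open>K\<close>, stated with \<open>\<kappa> k\<close> for late \<open>k\<close> instead of the limit.  By the maximum
  principle a bound on the frontier holds on \<open>K\<close>; doubling it gives a bound on a late sublevel set.
\<close>

lemma coeff_le_of_bounded_on_frontier:
  assumes "degree P \<le> m" "M > 0" and le: "\<And>w. w \<in> frontier K \<Longrightarrow> norm (poly P w) \<le> M"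
  shows "\<exists>k0. \<forall>k\<ge>k0. norm (coeff P m) \<le> 2 * M * exp (m * \<kappa> k)"
proof (cases "coeff P m = 0")
  case True
  then show ?thesis using assms(2) by (auto intro!: less_imp_le)
next
  case False
  then have deg: "degree P = m" using assms(1) by (simp add: le_antisym le_degree)
  have "norm (poly P w) < 2 * M" if "w \<in> K" for w
    using norm_poly_le_of_frontier[OF compact_K le that] assms(2) by simp
  then have "(\<Inter>n. sublevel n) \<subseteq> {w. norm (poly P w) < 2 * M}"
    unfolding K_eq_Inter_sublevel by blast
  moreover have "open {w. norm (poly P w) < 2 * M}"
    by (intro open_Collect_less continuous_intros)
  ultimately obtain k0 where k0: "\<And>k. k \<ge> k0 \<Longrightarrow> sublevel k \<subseteq> {w. norm (poly P w) < 2 * M}"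
    using eventually_subset_of_compact_Inter[OF compact_sublevel decseq_sublevel] by meson
  have "norm (coeff P m) \<le> 2 * M * exp (m * \<kappa> k)" if "k \<ge> k0" for k
  proof -
    define N where "N = d ^ k"
    define r where "r = exp (escape_log k)"
    have N: "N > 0" using d_ge_2 by (simp add: N_def)
    have r: "r \<ge> 1" using escape_log_pos[of k] by (simp add: r_def)
    have "norm (lead_coeff P) ^ degree (Q k) * r ^ degree P \<le>
          (2 * M) ^ degree (Q k) * norm (lead_coeff (Q k)) ^ degree P"
    proof (rule lead_coeff_bound_on_lemniscate)
      fix w assume "norm (poly (Q k) w) = r"
      then have "w \<in> sublevel k" by (simp add: sublevel_def r_def)
      then show "norm (poly P w) \<le> 2 * M" using k0[OF that] by auto
    qed (use degree_Q_pos r assms(2) in auto)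
    then have "norm (coeff P m) ^ N * r ^ m \<le> (2 * M) ^ N * exp (real N * \<kappa> k) ^ m"
      using norm_lead_Q[of k] by (simp add: deg degree_Q N_def)
    moreover have "norm (coeff P m) ^ N * 1 \<le> norm (coeff P m) ^ N * r ^ m"
      using r by (intro mult_left_mono one_le_power) auto
    moreover have "exp (real N * \<kappa> k) ^ m = exp (m * \<kappa> k) ^ N"
      by (simp add: exp_of_nat_mult[symmetric] mult_ac)
    ultimately have "norm (coeff P m) ^ N \<le> (2 * M * exp (m * \<kappa> k)) ^ N"
      by (simp add: power_mult_distrib)
    then show ?thesis using N assms(2) by (subst (asm) power_mono_iff) auto
  qed
  then show ?thesis by blast
qed

lemma norm_poly_f_le: "norm (poly (f n) w) \<le> exp C * max 1 (norm w) ^ d"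
proof -
  have "norm (poly (f n) w) \<le> (\<Sum>i\<le>d. norm (coeff (f n) i) * max 1 (norm w) ^ d)"
    unfolding poly_altdef degree_f
  proof (intro sum_norm_le)
    fix i assume "i \<in> {..d}"
    then have "norm w ^ i \<le> max 1 (norm w) ^ d"
      by (intro order_trans[OF power_mono[of "norm w" "max 1 (norm w)"]] power_increasing) auto
    then show "norm (coeff (f n) i * w ^ i) \<le> norm (coeff (f n) i) * max 1 (norm w) ^ d"
      by (simp add: norm_mult norm_power mult_left_mono)
  qed
  also have "\<dots> = (\<Sum>i\<le>d. norm (coeff (f n) i)) * max 1 (norm w) ^ d"
    by (simp add: sum_distrib_right)
  also have "\<dots> \<le> exp C * max 1 (norm w) ^ d"
    using coeff_sum_le by (intro mult_right_mono) auto
  finally show ?thesis .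
qed

text \<open>
  The logarithm of the iterates grows by at most the factor \<open>d\<close> plus a constant, so the normalised
  sequence becomes decreasing once \<open>C / d^n\<close> is added.
\<close>

lemma convergent_Green: "convergent (\<lambda>n. log_plus (norm (poly (Q n) w)) / real d ^ n)"
proof -
  define s where "s n = log_plus (norm (poly (Q n) w)) / real d ^ n" for n
  have step: "log_plus (norm (poly (Q (Suc n)) w)) \<le> C + d * log_plus (norm (poly (Q n) w))" for n
  proof -
    define m where "m = max 1 (norm (poly (Q n) w))"
    have m: "m \<ge> 1" by (simp add: m_def)
    have "norm (poly (Q (Suc n)) w) \<le> exp C * m ^ d"
      using norm_poly_f_le[of n "poly (Q n) w"] by (simp add: poly_pcompose m_def)
    moreover have "1 * 1 \<le> exp C * m ^ d"
      using C_ge_1 m by (intro mult_mono one_le_power) auto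
    ultimately have "ln (max 1 (norm (poly (Q (Suc n)) w))) \<le> ln (exp C * m ^ d)"
      by (intro ln_mono) auto
    also have "\<dots> = C + d * ln m"
      using m by (subst ln_mult_pos) (auto simp: ln_realpow)
    finally show ?thesis by (simp add: log_plus_def m_def)
  qed
  have "decseq (\<lambda>n. s n + C / real d ^ n)"
  proof (rule decseq_SucI)
    fix n
    have d: "real d \<ge> 2" using d_ge_2 by simp
    have "s (Suc n) \<le> (C + d * log_plus (norm (poly (Q n) w))) / real d ^ Suc n"
      unfolding s_def by (intro divide_right_mono step) auto
    also have "\<dots> = s n + C / real d ^ Suc n"
      using d by (simp add: s_def add_divide_distrib)
    finally have "s (Suc n) \<le> s n + C / real d ^ Suc n" .
    moreover have "2 * (C / real d ^ Suc n) \<le> C / real d ^ n"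
    proof -
      have "2 * (C / real d ^ Suc n) \<le> real d * (C / real d ^ Suc n)"
        using d C_ge_1 by (intro mult_right_mono) auto
      then show ?thesis using d by simp
    qed
    ultimately show "s (Suc n) + C / real d ^ Suc n \<le> s n + C / real d ^ n" by linarith
  qed
  moreover have "0 \<le> s n + C / real d ^ n" for n
    using C_ge_1 by (simp add: s_def log_plus_def)
  ultimately obtain l where l: "(\<lambda>n. s n + C / real d ^ n) \<longlonglongrightarrow> l"
    using decseq_convergent[of "\<lambda>n. s n + C / real d ^ n" 0] by blast
  have "(\<lambda>n. C * (1 / real d) ^ n) \<longlonglongrightarrow> C * 0"
    using d_ge_2 by (intro tendsto_mult tendsto_const LIMSEQ_power_zero) auto
  then have "(\<lambda>n. C / real d ^ n) \<longlonglongrightarrow> 0"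
    by (simp add: power_divide)
  from tendsto_diff[OF l this] have "s \<longlonglongrightarrow> l" by simp
  then show ?thesis unfolding s_def[symmetric] by (auto simp: convergent_def)
qed

lemma lim_Green_eq_0_iff:
  "lim (\<lambda>n. log_plus (norm (poly (Q n) w)) / real d ^ n) = 0 \<longleftrightarrow> w \<in> K"
proof
  assume "lim (\<lambda>n. log_plus (norm (poly (Q n) w)) / real d ^ n) = 0"
  moreover note convergent_Green[of w, unfolded convergent_LIMSEQ_iff]
  ultimately show "w \<in> K" unfolding null_Green_set_def by simp
qed (simp add: null_Green_set_def limI)

end

text \<open>
  Tempered growth alone would give \<open>|Q n| \<le> exp (const (3/2)^n)\<close> on \<open>K\<close>, which is too weak for the centroid
  argument: there the bound has to be small compared to \<open>d^n\<close>.  Hence the sequence is also required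
  to be tempered when restarted at the sparse times \<open>n = i 2^i\<close>, with a constant of order \<open>2^i\<close> only.
  At those times \<open>|Q n| \<le> exp (const 2^i)\<close> on \<open>K\<close>, while \<open>d^n \<ge> 2^(i 2^i)\<close>.  The factors
  \<open>2^i\<close> are the price of a summable weight for each of the restarts.
\<close>

locale sparse_sequence =
  fixes f :: "nat \<Rightarrow> complex poly" and d :: nat and C :: real
  assumes d_ge_2: "d \<ge> 2"
    and degree_f: "\<And>n. degree (f n) = d"
    and C_ge_1: "C \<ge> 1"
    and coeff_sum_le: "\<And>n. (\<Sum>i\<le>d. norm (coeff (f n) i)) \<le> exp C"
    and lead_ge_sparse: "\<And>i k. exp (- (C * 2 ^ i * (3/2) ^ k)) \<le> norm (lead_coeff (f (i * 2 ^ i + k)))"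
begin

lemma tempered_shift: "tempered_sequence (\<lambda>j. f (i * 2 ^ i + j)) d (C * 2 ^ i)"
proof
  have C: "C \<le> C * 2 ^ i" using C_ge_1 by simp
  then show "C * 2 ^ i \<ge> 1" using C_ge_1 by linarith
  show "(\<Sum>j\<le>d. norm (coeff (f (i * 2 ^ i + n)) j)) \<le> exp (C * 2 ^ i)" for n
    using coeff_sum_le C by (meson exp_le_cancel_iff order_trans)
qed (use d_ge_2 degree_f lead_ge_sparse in auto)

sublocale tempered_sequence
  using tempered_shift[of 0] by simp

lemma norm_Q_le:
  assumes "w \<in> K"
  shows "norm (poly (Q (i * 2 ^ i)) w) \<le> exp (2 * (C * 2 ^ i + 1))"
  using tempered_sequence.norm_le_of_K[OF tempered_shift] orbit_poly_mem_null_Green_set[OF assms] d_ge_2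
  by simp

end

lemma centroid_smult: "a \<noteq> 0 \<Longrightarrow> centroid (smult a P) = centroid P"
  by (simp add: centroid_def)

lemma centroid_orbit_poly:
  assumes "\<And>n. degree (f n) = d" "d \<ge> 2" "n \<ge> 1"
  shows "centroid (orbit_poly f n) = centroid (f 0)"
proof -
  have deg: "degree (orbit_poly f n) = d ^ n" for n
    by (induction n) (simp_all add: degree_pcompose assms)
  show ?thesis using assms(3)
  proof (induction n rule: dec_induct)
    case (step n)
    have "d ^ 1 \<le> d ^ n" using step.hyps assms(2) by (intro power_increasing) auto
    then have "degree (orbit_poly f n) \<ge> 2" using assms(2) by (simp add: deg)
    then show ?case using step.IH assms by (simp add: centroid_pcompose)
  qed simp
qed

text \<open>
  The factor \<open>N\<close> in the coefficient of \<open>X - Y\<close> at \<open>N - 1\<close> is what defeats all errors: they are of order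
  \<open>exp (const 2^i)\<close>, while \<open>N \<ge> 2^(i 2^i)\<close>.  Only the frontiers are assumed to correspond, which suffices
  because the capacity estimate asks for bounds on the frontier.
\<close>

theorem centroid_of_frontier_symmetry:
  assumes S: "sparse_sequence f d C" and S': "sparse_sequence f' d C"
    and c: "norm c = 1"
    and frontier: "frontier (null_Green_set f' d) = (\<lambda>w. c * w + e) ` frontier (null_Green_set f d)"
  shows "c * centroid (f 0) + e = centroid (f' 0)"
proof -
  interpret A: sparse_sequence f d C by fact
  interpret B: sparse_sequence f' d C by fact
  define \<delta> where "\<delta> = (centroid (f' 0) - e) / c - centroid (f 0)"
  have c0: "c \<noteq> 0" using c by auto
  have bound: "norm \<delta> \<le> 6 * exp (4 * C) * exp (4 * (C * 2 ^ i + 1)) / 2 ^ (i * 2 ^ i)" if "i \<ge> 1" for i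
  proof -
    define n where "n = i * 2 ^ i"
    define N where "N = d ^ n"
    define E where "E = exp (2 * (C * 2 ^ i + 1))"
    have n1: "n \<ge> 1" using that by (simp add: n_def)
    have E1: "E \<ge> 1" using A.C_ge_1 by (simp add: E_def)
    have "d ^ 1 \<le> d ^ n" using n1 A.d_ge_2 by (intro power_increasing) auto
    then have N2: "N \<ge> 2" using A.d_ge_2 by (simp add: N_def)
    have deg: "degree (A.Q n) = N" "degree (B.Q n) = N" by (simp_all add: N_def A.degree_Q B.degree_Q)
    define a where "a = lead_coeff (A.Q n)"
    define b where "b = lead_coeff (B.Q n)"
    have a: "norm a = exp (N * A.\<kappa> n)" and b: "norm b = exp (N * B.\<kappa> n)"
      by (simp_all add: a_def b_def A.norm_lead_Q B.norm_lead_Q N_def)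
    have a0: "a \<noteq> 0" and b0: "b \<noteq> 0" using a b by auto
    have lin: "degree [:u, v:] = 1" "lead_coeff [:u, v:] = v" if "v \<noteq> 0" for u v :: complex
      using that by auto
    define X where "X = smult (1 / a) (A.Q n)"
    define Y' where "Y' = pcompose (B.Q n) [:e, c:]"
    define Y where "Y = smult (1 / (b * c ^ N)) Y'"
    have degY': "degree Y' = N" "lead_coeff Y' = b * c ^ N"
      using c0 lin[of c e] lead_coeff_comp[of "[:e, c:]" "B.Q n"]
      by (simp_all only: Y'_def degree_pcompose deg b_def) simp_all
    have X: "degree X = N" "lead_coeff X = 1" "centroid X = centroid (f 0)"
      using a0 A.degree_f A.d_ge_2 n1
      by (simp_all add: X_def deg a_def centroid_smult centroid_orbit_poly)
    have Y: "degree Y = N" "lead_coeff Y = 1" "centroid Y = (centroid (f' 0) - e) / c"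
      using b0 c0 degY' B.degree_f B.d_ge_2 n1 N2
      by (simp_all add: Y_def centroid_smult centroid_orbit_poly)
         (simp add: Y'_def centroid_pcompose_linear deg centroid_orbit_poly)
    \<comment> \<open>Both \<open>X\<close> and \<open>Y\<close> are monic of degree \<open>N\<close>, so the coefficient of \<open>X - Y\<close> at \<open>N - 1\<close> compares
      their centroids.\<close>
    have second: "coeff P (N - 1) = - of_nat N * centroid P" if "degree P = N" "lead_coeff P = 1" for P
      using that N2 by (simp add: centroid_def)
    have co: "coeff (X - Y) (N - 1) = of_nat N * \<delta>"
      by (simp only: coeff_diff second[OF X(1,2)] second[OF Y(1,2)] X(3) Y(3) \<delta>_def) algebra
    have degXY: "degree (X - Y) \<le> N - 1"
    proof (rule degree_le, intro allI impI)
      fix k assume "k > N - 1"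
      then consider "k = N" | "k > N" by linarith
      then show "coeff (X - Y) k = 0"
        using X Y by cases (auto simp: coeff_eq_0)
    qed
    \<comment> \<open>To bound \<open>Y\<close> on the frontier of \<open>A.K\<close>, the leading coefficient of \<open>B.Q n\<close> must not be much smaller
      than that of \<open>A.Q n\<close>.  This is the capacity estimate for \<open>B.K\<close> applied to \<open>A.Q n\<close> transported there.\<close>
    have ab: "norm a \<le> 2 * E * exp C * norm b"
    proof -
      define Z where "Z = pcompose (A.Q n) [:- e / c, 1 / c:]"
      have degZ: "degree Z = N" "lead_coeff Z = a * (1 / c) ^ N"
        using c0 lin[of "1 / c" "- e / c"] lead_coeff_comp[of "[:- e / c, 1 / c:]" "A.Q n"]
        by (simp_all only: Z_def degree_pcompose deg a_def) simp_all
      have "norm (poly Z w) \<le> E" if w: "w \<in> frontier B.K" for w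
      proof -
        obtain v where v: "v \<in> frontier A.K" "w = c * v + e" using w frontier by auto
        then have "poly Z w = poly (A.Q n) v"
          using c0 by (simp add: Z_def poly_pcompose field_simps)
        moreover have "v \<in> A.K"
          using v A.compact_K by (meson compact_imp_closed frontier_subset_closed subsetD)
        ultimately show ?thesis using A.norm_Q_le[of v i] by (simp add: n_def E_def)
      qed
      then obtain k0 where "\<And>k. k \<ge> k0 \<Longrightarrow> norm (coeff Z N) \<le> 2 * E * exp (N * B.\<kappa> k)"
        using B.coeff_le_of_bounded_on_frontier[of Z N E] degZ E1 by auto
      then have "norm (coeff Z N) \<le> 2 * E * exp (N * B.\<kappa> (max k0 n))" by simp
      moreover have "norm (coeff Z N) = norm a"
        using degZ c by (simp add: norm_mult norm_power norm_divide)
      moreover have "N * B.\<kappa> (max k0 n) \<le> N * B.\<kappa> n + C"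
      proof -
        have "B.\<kappa> (max k0 n) \<le> B.\<kappa> n + C / N"
          using B.\<kappa>_le[of n "max k0 n"] A.C_ge_1 unfolding N_def
          by (smt (verit) divide_nonneg_nonneg max.cobounded2 of_nat_0_le_iff of_nat_power zero_le_power)
        then have "N * B.\<kappa> (max k0 n) \<le> N * (B.\<kappa> n + C / N)"
          by (intro mult_left_mono) auto
        then show ?thesis using N2 by (simp add: distrib_left)
      qed
      then have "2 * E * exp (N * B.\<kappa> (max k0 n)) \<le> 2 * E * exp (N * B.\<kappa> n + C)"
        using E1 by (intro mult_left_mono) auto
      ultimately show ?thesis by (simp add: b exp_add mult_ac)
    qed
    define M where "M = (E + 2 * E * E * exp C) / norm a"
    have M: "norm (poly (X - Y) w) \<le> M" if w: "w \<in> frontier A.K" for w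
    proof -
      have "w \<in> A.K"
        using w A.compact_K by (meson compact_imp_closed frontier_subset_closed subsetD)
      then have x: "norm (poly X w) \<le> E / norm a"
        using A.norm_Q_le[of w i] by (simp add: X_def n_def E_def norm_divide divide_right_mono)
      have "c * w + e \<in> frontier B.K" using w frontier by auto
      then have "c * w + e \<in> B.K"
        using B.compact_K by (meson compact_imp_closed frontier_subset_closed subsetD)
      then have "norm (poly (B.Q n) (c * w + e)) \<le> E"
        using B.norm_Q_le[of "c * w + e" i] by (simp add: n_def E_def)
      then have "norm (poly Y w) \<le> E / norm b"
        using c by (simp add: Y_def Y'_def poly_pcompose norm_divide norm_mult norm_power divide_right_mono algebra_simps)
      also have "E / norm b \<le> E * (2 * E * exp C) / norm a"
        using ab a0 b0 E1 mult_left_mono[OF ab, of E] by (simp add: field_simps)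
      finally have y: "norm (poly Y w) \<le> 2 * E * E * exp C / norm a" by (simp add: mult_ac)
      have "norm (poly (X - Y) w) \<le> norm (poly X w) + norm (poly Y w)"
        by (simp add: norm_triangle_ineq4)
      then show ?thesis using x y by (simp add: M_def add_divide_distrib)
    qed
    have M0: "M > 0" using E1 a0 by (simp add: M_def add_pos_pos)
    obtain k0 where "\<And>k. k \<ge> k0 \<Longrightarrow> norm (coeff (X - Y) (N - 1)) \<le> 2 * M * exp ((N - 1) * A.\<kappa> k)"
      using A.coeff_le_of_bounded_on_frontier[OF degXY M0 M] by auto
    then have "norm (coeff (X - Y) (N - 1)) \<le> 2 * M * exp ((N - 1) * A.\<kappa> (max k0 n))" by simp
    also have "(N - 1) * A.\<kappa> (max k0 n) \<le> (N - 1) * A.\<kappa> n + C"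
    proof -
      have "A.\<kappa> (max k0 n) \<le> A.\<kappa> n + C / N"
        using A.\<kappa>_le[of n "max k0 n"] A.C_ge_1 unfolding N_def
        by (smt (verit) divide_nonneg_nonneg max.cobounded2 of_nat_0_le_iff of_nat_power zero_le_power)
      then have "(N - 1) * A.\<kappa> (max k0 n) \<le> (N - 1) * (A.\<kappa> n + C / N)"
        by (intro mult_left_mono) auto
      also have "\<dots> = (N - 1) * A.\<kappa> n + C * ((N - 1) / N)"
        by (simp add: distrib_left mult_ac)
      also have "C * ((N - 1) / N) \<le> C * 1"
        using A.C_ge_1 N2 by (intro mult_left_mono) auto
      finally show ?thesis by simp
    qed
    also have "(N - 1) * A.\<kappa> n + C = N * A.\<kappa> n - A.\<kappa> n + C"
      using N2 by (simp add: of_nat_diff algebra_simps)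
    also have "\<dots> \<le> N * A.\<kappa> n + 3 * C"
      using A.\<kappa>_ge[of n] by simp
    finally have "norm (coeff (X - Y) (N - 1)) \<le> 2 * M * exp (N * A.\<kappa> n + 3 * C)"
      using M0 by simp
    also have "\<dots> = 2 * (E + 2 * E * E * exp C) * exp (3 * C)"
      using a0 by (simp add: M_def exp_add a)
    also have "\<dots> \<le> 2 * (E * E * exp C + 2 * E * E * exp C) * exp (3 * C)"
    proof -
      have "E * (1 * 1) \<le> E * (E * exp C)"
        using E1 A.C_ge_1 by (intro mult_left_mono mult_mono) auto
      then show ?thesis by (intro mult_right_mono) auto
    qed
    also have "\<dots> = 6 * exp (4 * C) * (E * E)"
      using exp_add[of C "3 * C"] by simp
    also have "E * E = exp (4 * (C * 2 ^ i + 1))"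
      by (simp add: E_def exp_add[symmetric])
    finally have "N * norm \<delta> \<le> 6 * exp (4 * C) * exp (4 * (C * 2 ^ i + 1))"
      unfolding co by (simp add: norm_mult)
    moreover have "2 ^ n * norm \<delta> \<le> N * norm \<delta>"
      using A.d_ge_2 by (intro mult_right_mono) (auto simp: N_def intro!: power_mono)
    ultimately have "2 ^ n * norm \<delta> \<le> 6 * exp (4 * C) * exp (4 * (C * 2 ^ i + 1))"
      by linarith
    then show ?thesis by (simp add: n_def field_simps)
  qed
  have "(\<lambda>i. 6 * exp (4 * C) * exp (4 * (C * 2 ^ i + 1)) / 2 ^ (i * 2 ^ i)) \<longlonglongrightarrow> (0::real)"
    using A.C_ge_1 by real_asymp
  then have "norm \<delta> \<le> 0"
    by (rule LIMSEQ_le_const) (use bound in blast)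
  then have "(centroid (f' 0) - e) / c = centroid (f 0)" by (simp add: \<delta>_def)
  then show ?thesis using c0 by (simp add: field_simps)
qed

section \<open>Generic points of the base Julia set\<close>

locale base_polynomial = sparse_sequence "\<lambda>_. p" "degree p" C
  for p :: "complex poly" and C :: real
begin

definition Rad :: real where "Rad = exp (2 * (C + 1))"

lemma Rad_gt_1: "Rad > 1"
  using C_ge_1 by (simp add: Rad_def)

lemma poly_Q: "poly (Q n) z = (poly p ^^ n) z"
  by (induction n) (simp_all add: poly_pcompose)

lemma Q_mem_K: "z \<in> K \<Longrightarrow> poly (Q n) z \<in> K"
  using orbit_poly_mem_null_Green_set[of z "\<lambda>_. p" "degree p" n] d_ge_2 by simp

lemma norm_Q_le_Rad: "z \<in> K \<Longrightarrow> norm (poly (Q n) z) \<le> Rad"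
  unfolding Rad_def by (intro norm_le_of_K Q_mem_K)

lemma eventually_norm_Q_ge:
  assumes "z \<notin> K"
  shows "\<exists>N. \<forall>n\<ge>N. B \<le> norm (poly (Q n) z)"
proof -
  obtain j where "norm (poly (Q j) z) > exp (escape_log j)"
    using assms by (auto simp: K_eq_Inter_sublevel sublevel_def not_le)
  from log_plus_liminf_pos[OF this] obtain c
    where c: "c > 0" "\<And>n. n \<ge> j \<Longrightarrow> c \<le> log_plus (norm (poly (Q n) z)) / real (degree p) ^ n" by blast
  obtain N where N: "max B 1 / c < 2 ^ N"
    using real_arch_pow[of 2] by auto
  have "B \<le> norm (poly (Q n) z)" if "n \<ge> max j N" for n
  proof -
    have "max B 1 / c < 2 ^ n"
      using N that by (meson max.boundedE order_less_le_trans one_le_numeral power_increasing)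
    also have "(2::real) ^ n \<le> real (degree p) ^ n"
      using d_ge_2 by (intro power_mono) auto
    finally have "max B 1 < c * real (degree p) ^ n"
      using c(1) by (simp add: field_simps)
    also have "\<dots> \<le> log_plus (norm (poly (Q n) z))"
      using c(2)[of n] that d_ge_2 by (simp add: field_simps)
    also have "\<dots> \<le> max 1 (norm (poly (Q n) z)) - 1"
      unfolding log_plus_def by (intro ln_le_minus_one) auto
    finally show ?thesis by (auto simp: max_def split: if_splits)
  qed
  then show ?thesis by blast
qed

lemma mem_K_of_bounded:
  assumes "\<And>n. n \<ge> m \<Longrightarrow> norm (poly (Q n) z) \<le> B"
  shows "z \<in> K"
proof (rule ccontr)
  assume "z \<notin> K"
  then obtain N where N: "\<And>n. n \<ge> N \<Longrightarrow> B + 1 \<le> norm (poly (Q n) z)"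
    using eventually_norm_Q_ge by metis
  show False using N[of "max m N"] assms[of "max m N"] by simp
qed

lemma Q_mem_K_iff: "poly (Q n) z \<in> K \<longleftrightarrow> z \<in> K"
proof
  assume K: "poly (Q n) z \<in> K"
  show "z \<in> K"
  proof (rule mem_K_of_bounded)
    fix m assume m: "m \<ge> n"
    have "poly (Q m) z = poly (Q (m - n)) (poly (Q n) z)"
      using m orbit_poly_add[of "\<lambda>_. p" n "m - n"] by (simp add: poly_pcompose)
    then show "norm (poly (Q m) z) \<le> Rad"
      using norm_Q_le_Rad[OF K] by simp
  qed
qed (rule Q_mem_K)

lemma base_filled_Julia_eq: "base_filled_Julia p = K"
proof (intro set_eqI iffI)
  fix z assume "z \<in> base_filled_Julia p"
  then obtain B where "\<And>n. n \<ge> 1 \<Longrightarrow> norm (poly (Q n) z) \<le> B"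
    unfolding base_filled_Julia_def bounded_iff by (auto simp: poly_Q)
  then show "z \<in> K" by (rule mem_K_of_bounded)
next
  fix z assume "z \<in> K"
  then show "z \<in> base_filled_Julia p"
    unfolding base_filled_Julia_def bounded_iff using norm_Q_le_Rad by (auto simp: poly_Q)
qed

lemma base_Julia_eq: "base_Julia p = frontier K"
  by (simp add: base_Julia_def base_filled_Julia_eq)

lemma frontier_K_subset: "frontier K \<subseteq> K"
  using compact_K by (simp add: compact_imp_closed frontier_subset_closed)

lemma norm_poly_p_gt:
  assumes "norm w > Rad"
  shows "norm (poly p w) > norm w"
proof -
  have w: "w \<noteq> 0" using assms Rad_gt_1 by auto
  have l: "ln (norm w) > escape_log 0"
    using assms w by (simp add: less_ln_iff escape_log_def Rad_def)
  have "real (degree p) * ln (norm w) \<ge> 2 * ln (norm w)"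
    using l escape_log_pos[of 0] d_ge_2 by (intro mult_right_mono) auto
  then have "ln (norm (poly p w)) \<ge> 2 * ln (norm w) - (C + 1) * (3/2) ^ 0"
    using ln_norm_step_ge(2)[OF l w] by (rule order_trans[OF diff_right_mono])
  then have "ln (norm (poly p w)) > ln (norm w)"
    using l C_ge_1 by (simp add: escape_log_def)
  then show ?thesis
    using ln_norm_step_ge(1)[OF l w] w by simp
qed

lemma norm_Q_le_of_later:
  assumes "norm (poly (Q n) z) \<le> r" "r \<ge> Rad" "k \<le> n"
  shows "norm (poly (Q k) z) \<le> r"
  using assms(3,1)
proof (induction n rule: dec_induct)
  case (step n)
  have "norm (poly p (poly (Q n) z)) \<le> r"
    using step.prems by (simp add: poly_pcompose)
  then have "norm (poly (Q n) z) \<le> r"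
    using norm_poly_p_gt[of "poly (Q n) z"] assms(2) by linarith
  then show ?case by (rule step.IH)
qed auto

text \<open>
  The sum of the geometric series of which the numbers \<open>\<kappa> n\<close> are the partial sums.
\<close>

definition \<kappa>_lim :: real where
  "\<kappa>_lim = ln (norm (lead_coeff p)) / (real (degree p) - 1)"

lemma \<kappa>_eq: "\<kappa> n = \<kappa>_lim - \<kappa>_lim / real (degree p) ^ n"
proof (induction n)
  case (Suc n)
  define x where "x = ln (norm (lead_coeff p))"
  define \<delta> where "\<delta> = real (degree p)"
  have \<delta>: "\<delta> \<ge> 2" using d_ge_2 by (simp add: \<delta>_def)
  have "\<kappa> (Suc n) = \<kappa> n + x / \<delta> ^ Suc n" by (simp add: \<kappa>_def x_def \<delta>_def)
  also have "\<dots> = \<kappa>_lim - \<kappa>_lim / \<delta> ^ n + x / \<delta> ^ Suc n"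
    unfolding Suc.IH by (simp add: \<delta>_def)
  also have "x = \<kappa>_lim * (\<delta> - 1)" using \<delta> by (simp add: \<kappa>_lim_def x_def \<delta>_def)
  also have "\<kappa>_lim - \<kappa>_lim / \<delta> ^ n + \<kappa>_lim * (\<delta> - 1) / \<delta> ^ Suc n = \<kappa>_lim - \<kappa>_lim / \<delta> ^ Suc n"
    using \<delta> by (simp add: field_simps)
  finally show ?case by (simp add: \<delta>_def)
qed (simp add: \<kappa>_def)

lemma \<kappa>_tendsto: "\<kappa> \<longlonglongrightarrow> \<kappa>_lim"
proof -
  have "(\<lambda>n. \<kappa>_lim * (1 / real (degree p)) ^ n) \<longlonglongrightarrow> \<kappa>_lim * 0"
    using d_ge_2 by (intro tendsto_mult tendsto_const LIMSEQ_power_zero) auto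
  then have "(\<lambda>n. \<kappa>_lim - \<kappa>_lim * (1 / real (degree p)) ^ n) \<longlonglongrightarrow> \<kappa>_lim - 0"
    by (intro tendsto_diff tendsto_const) simp
  then show ?thesis
    by (simp add: \<kappa>_eq[abs_def] power_divide)
qed

text \<open>
  The mean of \<open>ln |P|\<close> with respect to the equilibrium measure of \<open>K\<close> is at least
  \<open>ln |lead_coeff P| - degree P * \<kappa>_lim\<close>, so the last condition bounds this mean below by \<open>- D\<close>.  It is
  additive in \<open>P\<close> and mentions no measure.
\<close>

definition tame :: "real \<Rightarrow> complex poly \<Rightarrow> bool" where
  "tame D P \<longleftrightarrow> P \<noteq> 0 \<and> (\<forall>z\<in>K. norm (poly P z) < exp D) \<and>
     degree P * \<kappa>_lim - D \<le> ln (norm (lead_coeff P))"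

lemma tame_mult:
  assumes "tame D P" "tame D' P'"
  shows "tame (D + D') (P * P')"
proof -
  have nz: "P \<noteq> 0" "P' \<noteq> 0" using assms by (auto simp: tame_def)
  then have "ln (norm (lead_coeff (P * P'))) = ln (norm (lead_coeff P)) + ln (norm (lead_coeff P'))"
    unfolding lead_coeff_mult by (simp add: norm_mult ln_mult)
  moreover have "degree (P * P') = degree P + degree P'"
    using nz by (rule degree_mult_eq)
  ultimately show ?thesis
    using assms nz unfolding tame_def
    by (auto simp: norm_mult exp_add algebra_simps intro!: mult_strict_mono')
qed

lemma tame_mono: "tame D P \<Longrightarrow> D \<le> D' \<Longrightarrow> tame D' P"
  unfolding tame_def by (meson diff_left_mono exp_le_cancel_iff order_less_le_trans order_trans)

lemma tame_prod:
  assumes "finite A" "\<And>x. x \<in> A \<Longrightarrow> tame D (P x)"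
  shows "tame (1 + real (card A) * D) (\<Prod>x\<in>A. P x)"
  using assms
proof (induction A)
  case empty
  then show ?case by (simp add: tame_def)
next
  case (insert x A)
  then have "tame (D + (1 + real (card A) * D)) (P x * (\<Prod>x\<in>A. P x))"
    by (intro tame_mult) auto
  moreover have "D + (1 + real (card A) * D) = 1 + real (card (insert x A)) * D"
    using insert by (simp add: algebra_simps)
  ultimately show ?case using insert by simp
qed

lemma tame_linear:
  assumes "norm x \<le> r" "r + Rad < exp D" "\<kappa>_lim \<le> D"
  shows "tame D [:- x, 1:]"
proof -
  have "norm (z - x) < exp D" if "z \<in> K" for z
    using norm_Q_le_Rad[OF that, of 0] norm_triangle_ineq4[of z x] assms by simp
  then show ?thesis using assms by (simp add: tame_def)
qed

text \<open>
  The constant does not depend on the iterate, because \<open>degree p ^ n * (\<kappa> n - \<kappa>_lim)\<close> is constant and a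
  leading coefficient of absolute value 1 in the affine map does not change the leading coefficient in norm.
\<close>

lemma tame_pcompose_orbit:
  assumes "b \<noteq> 0" "norm c = 1" "\<And>z. z \<in> K \<Longrightarrow> c * z + e \<in> K"
  shows "\<exists>D. \<forall>n. tame D (pcompose b (pcompose (Q n) [:e, c:]))"
proof -
  have "bounded (poly b ` cball 0 Rad)"
    by (intro compact_imp_bounded compact_continuous_image continuous_intros) auto
  then obtain B where B: "B > 0" "\<And>w. norm w \<le> Rad \<Longrightarrow> norm (poly b w) \<le> B"
    unfolding bounded_pos by auto
  define D where "D = max (B + 1) (degree b * \<kappa>_lim - ln (norm (lead_coeff b)))"
  have c0: "c \<noteq> 0" using assms(2) by auto
  have "tame D (pcompose b (pcompose (Q n) [:e, c:]))" for n
  proof -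
    define N where "N = degree p ^ n"
    have N: "N > 0" using d_ge_2 by (simp add: N_def)
    have deg1: "degree (pcompose (Q n) [:e, c:]) = N"
      using c0 by (simp add: degree_pcompose degree_Q N_def)
    then have deg: "degree (pcompose b (pcompose (Q n) [:e, c:])) = degree b * N"
      by (simp add: degree_pcompose)
    have "lead_coeff (pcompose (Q n) [:e, c:]) = lead_coeff (Q n) * c ^ N"
      using lead_coeff_comp[of "[:e, c:]" "Q n"] c0 by (simp add: degree_Q N_def)
    then have "norm (lead_coeff (pcompose (Q n) [:e, c:])) = exp (real N * \<kappa> n)"
      using assms(2) norm_lead_Q[of n] by (simp add: norm_mult norm_power N_def)
    moreover have "lead_coeff (pcompose b (pcompose (Q n) [:e, c:])) =
          lead_coeff b * lead_coeff (pcompose (Q n) [:e, c:]) ^ degree b"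
      using deg1 N by (intro lead_coeff_comp) simp
    ultimately have "norm (lead_coeff (pcompose b (pcompose (Q n) [:e, c:]))) =
        norm (lead_coeff b) * exp (real N * \<kappa> n) ^ degree b"
      by (simp add: norm_mult norm_power)
    also have "exp (real N * \<kappa> n) ^ degree b = exp (degree b * (real N * \<kappa> n))"
      by (simp add: exp_of_nat_mult)
    finally have "ln (norm (lead_coeff (pcompose b (pcompose (Q n) [:e, c:])))) =
        ln (norm (lead_coeff b)) + degree b * (real N * \<kappa> n)"
      using assms(1) by (simp add: ln_mult)
    also have "real N * \<kappa> n = real N * \<kappa>_lim - \<kappa>_lim"
      using N by (simp add: \<kappa>_eq N_def field_simps)
    finally have "ln (norm (lead_coeff (pcompose b (pcompose (Q n) [:e, c:])))) \<ge>
        real (degree b * N) * \<kappa>_lim - D"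
      by (simp add: D_def algebra_simps)
    moreover have "pcompose b (pcompose (Q n) [:e, c:]) \<noteq> 0"
      using assms(1) deg1 N by (auto simp: pcompose_eq_0_iff)
    moreover have "norm (poly (pcompose b (pcompose (Q n) [:e, c:])) z) < exp D" if "z \<in> K" for z
    proof -
      have "norm (poly (pcompose b (pcompose (Q n) [:e, c:])) z) \<le> B"
        using B(2) norm_Q_le_Rad[OF assms(3)[OF that], of n] by (simp add: poly_pcompose algebra_simps)
      also have "B < D" by (simp add: D_def)
      also have "D < exp D" using exp_ge_add_one_self[of D] by linarith
      finally show ?thesis .
    qed
    ultimately show ?thesis unfolding tame_def deg by simp
  qed
  then show ?thesis by blast
qed

text \<open>
  These sets decrease to \<open>K\<close> and contain the preimages of a point at distance \<open>Rad + 1\<close> from 0.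
\<close>

definition trapped :: "nat \<Rightarrow> complex set" where
  "trapped n = (\<Inter>k\<le>n. {z. norm (poly (Q k) z) \<le> Rad + 1})"

lemma compact_trapped: "compact (trapped n)"
proof -
  have "compact {z. norm (poly (Q k) z) \<le> Rad + 1}" for k
    by (intro compact_poly_sublevel degree_Q_pos)
  then show ?thesis unfolding trapped_def by (intro compact_Inter) auto
qed

lemma decseq_trapped: "decseq trapped"
  unfolding decseq_def trapped_def by fastforce

lemma Inter_trapped: "(\<Inter>n. trapped n) = K"
proof
  show "(\<Inter>n. trapped n) \<subseteq> K"
  proof
    fix z assume "z \<in> (\<Inter>n. trapped n)"
    then have "norm (poly (Q n) z) \<le> Rad + 1" for n
      unfolding trapped_def by blast
    then show "z \<in> K" by (rule mem_K_of_bounded)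
  qed
  show "K \<subseteq> (\<Inter>n. trapped n)"
  proof
    fix z assume "z \<in> K"
    then have "norm (poly (Q k) z) \<le> Rad + 1" for k
      using norm_Q_le_Rad[of z k] by linarith
    then show "z \<in> (\<Inter>n. trapped n)" unfolding trapped_def by blast
  qed
qed

text \<open>
  The multiset of solutions of \<open>p^n(z) = Rad + 1\<close>.  The value lies outside \<open>K\<close> at distance at least 1, so
  \<open>|p^n(y) - (Rad + 1)| \<ge> 1\<close> for \<open>y\<close> in \<open>K\<close>, and solutions stay outside \<open>K\<close> but accumulate only on it.
\<close>

definition preimages :: "nat \<Rightarrow> complex multiset" where
  "preimages n = proots (Q n - [:of_real (Rad + 1):])"

lemma size_preimages: "size (preimages n) = degree p ^ n"
  using degree_Q_pos[of n] by (simp add: preimages_def size_proots_complex degree_sub_const degree_Q)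

lemma poly_Q_preimages:
  assumes "z \<in># preimages n"
  shows "poly (Q n) z = of_real (Rad + 1)"
proof -
  have "Q n - [:of_real (Rad + 1):] \<noteq> 0"
    using degree_Q_pos[of n] degree_sub_const[of "Q n" "of_real (Rad + 1)"] by auto
  then show ?thesis using assms by (simp add: preimages_def)
qed

lemma preimages_in_trapped:
  assumes "z \<in># preimages n"
  shows "z \<in> trapped n" "z \<notin> K"
proof -
  have n: "norm (poly (Q n) z) = Rad + 1"
    using poly_Q_preimages[OF assms] Rad_gt_1 by (simp only: norm_of_real)
  then show "z \<in> trapped n"
    unfolding trapped_def using norm_Q_le_of_later[of n z "Rad + 1"] by auto
  show "z \<notin> K" using n norm_Q_le_Rad[of z n] by auto
qed

text \<open>
  By reciprocity, the mean of \<open>ln |P|\<close> over the preimages is governed by the values of \<open>p^n - (Rad + 1)\<close> at the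
  zeros \<open>y\<close> of \<open>P\<close>.  Each factor is eventually at least 1 in absolute value: on \<open>K\<close> because
  iterates stay within \<open>Rad\<close>, off \<open>K\<close> because they tend to infinity.
\<close>

lemma average_over_preimages:
  fixes D :: real
  assumes "tame D P"
  shows "\<exists>n0. \<forall>n\<ge>n0. (\<forall>z\<in>#preimages n. poly P z \<noteq> 0 \<and> ln (norm (poly P z)) \<le> D) \<and>
      (\<Sum>z\<in>#preimages n. D - ln (norm (poly P z))) \<le> real (degree p ^ n) * (2 * D + 1)"
proof -
  have P: "P \<noteq> 0" "K \<subseteq> {z. norm (poly P z) < exp D}"
      "degree P * \<kappa>_lim - D \<le> ln (norm (lead_coeff P))"
    using assms by (auto simp: tame_def)
  have "open {z. norm (poly P z) < exp D}"
    by (intro open_Collect_less continuous_intros)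
  then obtain n1 where n1: "\<And>n. n \<ge> n1 \<Longrightarrow> trapped n \<subseteq> {z. norm (poly P z) < exp D}"
    using eventually_subset_of_compact_Inter[OF compact_trapped decseq_trapped] P(2) unfolding Inter_trapped by blast
  have "\<exists>m. \<forall>n\<ge>m. 1 \<le> norm (poly (Q n) y - of_real (Rad + 1))" for y
  proof (cases "y \<in> K")
    case True
    have "1 \<le> norm (poly (Q n) y - of_real (Rad + 1))" for n
    proof -
      have "norm (of_real (Rad + 1) :: complex) = Rad + 1"
        using Rad_gt_1 by (simp only: norm_of_real)
      then show ?thesis
        using norm_Q_le_Rad[OF True, of n] norm_triangle_ineq3[of "poly (Q n) y" "of_real (Rad + 1)"]
        by linarith
    qed
    then show ?thesis by blast
  next
    case False
    obtain m where "\<And>n. n \<ge> m \<Longrightarrow> Rad + 2 \<le> norm (poly (Q n) y)"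
      using eventually_norm_Q_ge[OF False] by metis
    moreover have "norm (of_real (Rad + 1) :: complex) = Rad + 1"
      using Rad_gt_1 by (simp only: norm_of_real)
    ultimately have "1 \<le> norm (poly (Q n) y - of_real (Rad + 1))" if "n \<ge> m" for n
      using \<open>\<And>n. n \<ge> m \<Longrightarrow> Rad + 2 \<le> norm (poly (Q n) y)\<close>[OF that]
        norm_triangle_ineq2[of "poly (Q n) y" "of_real (Rad + 1)"] by linarith
    then show ?thesis by blast
  qed
  then obtain m where m: "\<And>y n. n \<ge> m y \<Longrightarrow> 1 \<le> norm (poly (Q n) y - of_real (Rad + 1))"
    by metis
  have "(\<lambda>n. degree P * \<kappa> n) \<longlonglongrightarrow> degree P * \<kappa>_lim"
    by (intro tendsto_mult tendsto_const \<kappa>_tendsto)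
  then have "\<forall>\<^sub>F n in sequentially. degree P * \<kappa> n < degree P * \<kappa>_lim + 1"
    by (rule order_tendstoD) simp
  then obtain n2 where n2: "\<And>n. n \<ge> n2 \<Longrightarrow> degree P * \<kappa> n < degree P * \<kappa>_lim + 1"
    unfolding eventually_sequentially by blast
  define n0 where "n0 = Max ({n1, n2} \<union> m ` set_mset (proots P))"
  have n0: "n0 \<ge> n1" "n0 \<ge> n2" "\<And>y. y \<in># proots P \<Longrightarrow> n0 \<ge> m y"
    unfolding n0_def by (intro Max_ge; simp)+
  have "(\<forall>z\<in>#preimages n. poly P z \<noteq> 0 \<and> ln (norm (poly P z)) \<le> D) \<and>
      (\<Sum>z\<in>#preimages n. D - ln (norm (poly P z))) \<le> real (degree p ^ n) * (2 * D + 1)" if n: "n \<ge> n0" for n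
  proof -
    define N where "N = degree p ^ n"
    define Q' where "Q' = Q n - [:of_real (Rad + 1):]"
    have deg: "degree Q' = N"
      unfolding Q'_def N_def degree_sub_const[OF degree_Q_pos] by (rule degree_Q)
    have lead: "norm (lead_coeff Q') = exp (N * \<kappa> n)"
      unfolding Q'_def lead_coeff_sub_const[OF degree_Q_pos] norm_lead_Q by (simp add: N_def)
    have "1 \<le> norm (poly Q' y)" if "y \<in># proots P" for y
      using m[of y n] n0(3)[OF that] n by (simp add: Q'_def)
    then have "1 \<le> (\<Prod>y\<in>#proots P. norm (poly Q' y))"
      by (rule prod_mset_ge_1)
    then have "norm (lead_coeff P) ^ N * 1 \<le>
        norm (lead_coeff P) ^ degree Q' * (\<Prod>y\<in>#proots P. norm (poly Q' y))"
      unfolding deg by (intro mult_left_mono) auto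
    also have "\<dots> = norm (lead_coeff Q') ^ degree P * (\<Prod>z\<in>#preimages n. norm (poly P z))"
      unfolding preimages_def Q'_def[symmetric] by (rule resultant_reciprocity[symmetric])
    finally have ge: "norm (lead_coeff P) ^ N \<le> exp (N * \<kappa> n) ^ degree P * (\<Prod>z\<in>#preimages n. norm (poly P z))"
      unfolding lead by simp
    have "norm (lead_coeff P) ^ N > 0" using P by simp
    have prod0: "(\<Prod>z\<in>#preimages n. norm (poly P z)) \<noteq> 0"
    proof
      assume "(\<Prod>z\<in>#preimages n. norm (poly P z)) = 0"
      with ge have "norm (lead_coeff P) ^ N \<le> 0" by (simp only: mult_zero_right)
      with \<open>norm (lead_coeff P) ^ N > 0\<close> show False by linarith
    qed
    then have nz: "poly P z \<noteq> 0" if "z \<in># preimages n" for z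
      using that by (auto simp: prod_mset_zero_iff)
    have lnprod: "ln (\<Prod>z\<in>#preimages n. norm (poly P z)) = (\<Sum>z\<in>#preimages n. ln (norm (poly P z)))"
      "(\<Prod>z\<in>#preimages n. norm (poly P z)) > 0"
      using ln_prod_mset[of "preimages n" "\<lambda>z. norm (poly P z)"] nz by auto
    have "ln (norm (lead_coeff P) ^ N) \<le> ln (exp (N * \<kappa> n) ^ degree P * (\<Prod>z\<in>#preimages n. norm (poly P z)))"
      using ge P by (intro ln_mono) auto
    also have "\<dots> = ln (exp (N * \<kappa> n) ^ degree P) + (\<Sum>z\<in>#preimages n. ln (norm (poly P z)))"
      unfolding lnprod(1)[symmetric] using lnprod(2) by (intro ln_mult_pos) auto
    finally have "real N * ln (norm (lead_coeff P)) \<le>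
        degree P * (N * \<kappa> n) + (\<Sum>z\<in>#preimages n. ln (norm (poly P z)))"
      using P(1) by (simp add: ln_realpow)
    moreover have "real N * (degree P * \<kappa>_lim - D) \<le> N * ln (norm (lead_coeff P))"
      using P(3) by (intro mult_left_mono) auto
    moreover have "N * (degree P * \<kappa> n) \<le> N * (degree P * \<kappa>_lim + 1)"
      using n2[of n] n n0 by (intro mult_left_mono) auto
    ultimately have "(\<Sum>z\<in>#preimages n. ln (norm (poly P z))) \<ge> - (real N * (D + 1))"
      by (simp add: algebra_simps)
    moreover have "(\<Sum>z\<in>#preimages n. D - ln (norm (poly P z))) =
        real N * D - (\<Sum>z\<in>#preimages n. ln (norm (poly P z)))"
    proof -
      have "(\<Sum>z\<in>#A. D - ln (norm (poly P z))) = real (size A) * D - (\<Sum>z\<in>#A. ln (norm (poly P z)))" for A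
        by (induction A) (auto simp: algebra_simps)
      then show ?thesis by (simp add: size_preimages N_def)
    qed
    ultimately have "(\<Sum>z\<in>#preimages n. D - ln (norm (poly P z))) \<le> real N * (2 * D + 1)"
      by (simp add: algebra_simps)
    moreover have "ln (norm (poly P z)) \<le> D" if "z \<in># preimages n" for z
    proof -
      have "norm (poly P z) < exp D"
        using n1[of n] n n0(1) preimages_in_trapped(1)[OF that] by auto
      then show ?thesis using nz[OF that] by (simp add: ln_le_iff_le_exp)
    qed
    ultimately show ?thesis using nz by (simp add: N_def)
  qed
  then show ?thesis by blast
qed

text \<open>
  For finitely many \<open>i\<close> the weighted mean of the nonnegative quantities \<open>D - ln |P i z|\<close> over late preimages is
  bounded by a constant independent of how many \<open>i\<close> are involved, so some preimage satisfies all the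
  bounds.  A limit point of such preimages lies in \<open>K\<close> and is a limit of points outside \<open>K\<close>.
\<close>

theorem generic_point:
  fixes P :: "'i::countable \<Rightarrow> complex poly" and \<omega> :: "'i \<Rightarrow> real"
  assumes tame: "\<And>i. tame D (P i)" and D: "D \<ge> 0"
    and \<omega>: "\<And>i. \<omega> i > 0" and W: "\<And>F. finite F \<Longrightarrow> sum \<omega> F \<le> W"
  shows "\<exists>z \<in> frontier K. \<forall>i. exp (- (W * (2 * D + 1) / \<omega> i)) \<le> norm (poly (P i) z)"
proof -
  define W' where "W' = W * (2 * D + 1)"
  have "\<exists>z. z \<in> trapped m \<and> z \<notin> K \<and> (\<forall>i. to_nat i < m \<longrightarrow> exp (- (W' / \<omega> i)) \<le> norm (poly (P i) z))" for m
  proof -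
    define F where "F = {i::'i. to_nat i < m}"
    have "finite (to_nat ` F)" unfolding F_def by (rule finite_subset[of _ "{..<m}"]) auto
    then have fin: "finite F" by (rule finite_imageD) (simp add: inj_on_def)
    have "\<forall>i. \<exists>n0. \<forall>n\<ge>n0. (\<forall>z\<in>#preimages n. poly (P i) z \<noteq> 0 \<and> ln (norm (poly (P i) z)) \<le> D) \<and>
        (\<Sum>z\<in>#preimages n. D - ln (norm (poly (P i) z))) \<le> real (degree p ^ n) * (2 * D + 1)"
      by (intro allI average_over_preimages tame)
    then obtain n0 where n0':
      "\<forall>i. \<forall>n\<ge>n0 i. (\<forall>z\<in>#preimages n. poly (P i) z \<noteq> 0 \<and> ln (norm (poly (P i) z)) \<le> D) \<and>
        (\<Sum>z\<in>#preimages n. D - ln (norm (poly (P i) z))) \<le> real (degree p ^ n) * (2 * D + 1)"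
      unfolding choice_iff by blast
    have n0:
      "poly (P i) z \<noteq> 0 \<and> ln (norm (poly (P i) z)) \<le> D" if "n \<ge> n0 i" "z \<in># preimages n" for i n z
      using n0'[rule_format, OF that(1)] that(2) by blast
    have n0s: "(\<Sum>z\<in>#preimages n. D - ln (norm (poly (P i) z))) \<le> real (degree p ^ n) * (2 * D + 1)"
      if "n \<ge> n0 i" for i n
      using n0'[rule_format, OF that] by (rule conjunct2)
    define n where "n = Max (insert m (n0 ` F))"
    have n: "n \<ge> m" "\<And>i. i \<in> F \<Longrightarrow> n \<ge> n0 i" using fin by (auto simp: n_def)
    define h where "h z = (\<Sum>i\<in>F. \<omega> i * (D - ln (norm (poly (P i) z))))" for z
    have swap: "(\<Sum>z\<in>#A. h z) = (\<Sum>i\<in>F. \<omega> i * (\<Sum>z\<in>#A. D - ln (norm (poly (P i) z))))" for A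
      by (induction A) (auto simp: h_def distrib_left sum.distrib)
    have "(\<Sum>z\<in>#preimages n. h z) \<le> (\<Sum>i\<in>F. \<omega> i * (real (degree p ^ n) * (2 * D + 1)))"
      unfolding swap by (intro sum_mono mult_left_mono n0s n(2) less_imp_le[OF \<omega>])
    also have "\<dots> = sum \<omega> F * (real (degree p ^ n) * (2 * D + 1))"
      by (simp add: sum_distrib_right)
    also have "\<dots> \<le> W * (real (degree p ^ n) * (2 * D + 1))"
      using W[OF fin] D by (intro mult_right_mono) auto
    finally have total: "(\<Sum>z\<in>#preimages n. h z) \<le> real (degree p ^ n) * W'"
      by (simp add: W'_def mult_ac)
    have "\<exists>z\<in>#preimages n. h z \<le> W'"
    proof (rule ccontr)
      assume neg: "\<not> (\<exists>z\<in>#preimages n. h z \<le> W')"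
      define m where "m = Min (h ` set_mset (preimages n))"
      have ne: "set_mset (preimages n) \<noteq> {}"
        using size_preimages[of n] d_ge_2 by (auto simp: set_mset_eq_empty_iff)
      have "m > W'"
        using neg ne unfolding m_def by (subst Min_gr_iff) (auto simp: not_le)
      have "real (size (preimages n)) * m \<le> (\<Sum>z\<in>#preimages n. h z)"
        unfolding m_def by (intro sum_mset_ge_const Min_le) auto
      also note total
      finally have "m \<le> W'"
        using d_ge_2 by (simp add: size_preimages)
      with \<open>m > W'\<close> show False by simp
    qed
    then obtain z where z: "z \<in># preimages n" "h z \<le> W'" by blast
    have "exp (- (W' / \<omega> i)) \<le> norm (poly (P i) z)" if "to_nat i < m" for i
    proof -
      have i: "i \<in> F" using that by (simp add: F_def)
      have ln: "poly (P j) z \<noteq> 0" "ln (norm (poly (P j) z)) \<le> D" if "j \<in> F" for j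
        using n0[OF n(2)[OF that] z(1)] by auto
      have "\<omega> i * (D - ln (norm (poly (P i) z))) \<le> h z"
        unfolding h_def using ln(2) \<omega> by (intro member_le_sum i fin) (auto intro!: mult_nonneg_nonneg less_imp_le[OF \<omega>])
      then have "\<omega> i * (D - ln (norm (poly (P i) z))) \<le> W'" using z(2) by linarith
      then have "D - ln (norm (poly (P i) z)) \<le> W' / \<omega> i" using \<omega>[of i] by (simp add: field_simps)
      then have "ln (norm (poly (P i) z)) \<ge> - (W' / \<omega> i)" using D by linarith
      then show ?thesis using ln(1)[OF i] by (simp add: ln_ge_iff)
    qed
    moreover have "z \<in> trapped m"
      using preimages_in_trapped(1)[OF z(1)] decseq_trapped n(1) unfolding decseq_def by blast
    ultimately show ?thesis using preimages_in_trapped(2)[OF z(1)] by blast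
  qed
  then obtain x where x: "\<And>m. x m \<in> trapped m" "\<And>m. x m \<notin> K"
    "\<And>m i. to_nat i < m \<Longrightarrow> exp (- (W' / \<omega> i)) \<le> norm (poly (P i) (x m))" by metis
  have "\<forall>m. x m \<in> trapped 0" using x(1) decseq_trapped unfolding decseq_def by blast
  then obtain z r where r: "strict_mono r" and lim: "(x \<circ> r) \<longlonglongrightarrow> z"
    using compact_trapped[of 0] unfolding compact_def by blast
  have closed: "z \<in> S" if "closed S" "\<And>m. m \<ge> k \<Longrightarrow> x m \<in> S" for S k
  proof (rule Lim_in_closed_set[OF that(1) _ _ lim])
    have "(x \<circ> r) m \<in> S" if "m \<ge> k" for m
      using \<open>\<And>m. m \<ge> k \<Longrightarrow> x m \<in> S\<close>[of "r m"] seq_suble[OF r, of m] that by auto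
    then show "\<forall>\<^sub>F m in sequentially. (x \<circ> r) m \<in> S"
      unfolding eventually_sequentially by blast
  qed simp
  have "z \<in> trapped k" for k
  proof (rule closed[of _ k])
    show "closed (trapped k)" using compact_trapped by (rule compact_imp_closed)
    show "x m \<in> trapped k" if "m \<ge> k" for m
      using x(1)[of m] that decseq_trapped unfolding decseq_def by blast
  qed
  then have "z \<in> K" unfolding Inter_trapped[symmetric] by blast
  moreover have "z \<notin> interior K"
  proof
    have "closed (- interior K)" by (simp add: closed_Compl)
    then have "z \<in> - interior K"
      by (rule closed[of _ 0]) (use x(2) interior_subset in blast)
    moreover assume "z \<in> interior K"
    ultimately show False by simp
  qed
  ultimately have "z \<in> frontier K"
    unfolding frontier_def using closure_subset by blast
  moreover have "exp (- (W' / \<omega> i)) \<le> norm (poly (P i) z)" for i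
  proof -
    have "closed {w. exp (- (W' / \<omega> i)) \<le> norm (poly (P i) w)}"
      by (intro closed_Collect_le continuous_intros)
    then have "z \<in> {w. exp (- (W' / \<omega> i)) \<le> norm (poly (P i) w)}"
      by (rule closed[of _ "Suc (to_nat i)"]) (use x(3) in auto)
    then show ?thesis by simp
  qed
  ultimately show ?thesis unfolding W'_def by blast
qed

text \<open>
  The pair \<open>(i, k)\<close> gets the weight \<open>2^(- i) (2/3)^k\<close>; the inverse weights are the growth rates that
  \<open>sparse_sequence\<close> admits.
\<close>

corollary generic_point_sparse:
  fixes P :: "nat \<Rightarrow> complex poly"
  assumes tame: "\<And>n. tame D (P n)"
  shows "\<exists>z \<in> frontier K. \<exists>c\<ge>0. \<forall>i k. exp (- (c * 2 ^ i * (3/2) ^ k)) \<le> norm (poly (P (i * 2 ^ i + k)) z)"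
proof -
  define \<omega> :: "nat \<times> nat \<Rightarrow> real" where "\<omega> = (\<lambda>(i, k). (1/2) ^ i * (2/3) ^ k)"
  define c where "c = 6 * (2 * max D 0 + 1)"
  have geo: "(\<Sum>i<n. r ^ i) \<le> 1 / (1 - r)" if "0 < r" "r < 1" for r :: real and n
  proof -
    have "(\<Sum>i<n. r ^ i) = (1 - r ^ n) / (1 - r)"
      using that by (subst geometric_sum) (auto simp: field_simps)
    also have "\<dots> \<le> 1 / (1 - r)" using that by (intro divide_right_mono) auto
    finally show ?thesis .
  qed
  have "sum \<omega> F \<le> 6" if "finite F" for F
  proof -
    obtain n where n: "F \<subseteq> {..<n} \<times> {..<n}"
    proof -
      have "finite (fst ` F \<union> snd ` F)" using \<open>finite F\<close> by simp
      then obtain n where "\<forall>x \<in> fst ` F \<union> snd ` F. x < n"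
        unfolding finite_nat_set_iff_bounded by blast
      then have "F \<subseteq> {..<n} \<times> {..<n}" by force
      then show ?thesis using that by blast
    qed
    have "sum \<omega> F \<le> sum \<omega> ({..<n} \<times> {..<n})"
      by (intro sum_mono2 n) (auto simp: \<omega>_def)
    also have "\<dots> = (\<Sum>i<n. (1/2) ^ i) * (\<Sum>k<n. (2/3) ^ k)"
      by (simp add: sum_product sum.cartesian_product \<omega>_def)
    also have "\<dots> \<le> (1 / (1 - 1/2)) * (1 / (1 - 2/3))"
      by (intro mult_mono geo sum_nonneg) auto
    finally show ?thesis by simp
  qed
  moreover have "tame (max D 0) (case ik of (i, k) \<Rightarrow> P (i * 2 ^ i + k))" for ik
    using tame_mono[OF tame] by (cases ik) auto
  moreover have "\<omega> ik > 0" for ik by (cases ik) (auto simp: \<omega>_def)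
  ultimately obtain z where z: "z \<in> frontier K"
    and ge: "\<And>ik. exp (- (c / \<omega> ik)) \<le> norm (poly (case ik of (i, k) \<Rightarrow> P (i * 2 ^ i + k)) z)"
    using generic_point[of "max D 0" "\<lambda>(i, k). P (i * 2 ^ i + k)" \<omega> 6] unfolding c_def by auto
  have "exp (- (c * 2 ^ i * (3/2) ^ k)) \<le> norm (poly (P (i * 2 ^ i + k)) z)" for i k
    using ge[of "(i, k)"] by (simp add: \<omega>_def power_divide mult_ac)
  moreover have "c \<ge> 0" by (simp add: c_def)
  ultimately show ?thesis using z by blast
qed

end

section \<open>Fibers over generic points\<close>

lemma coeff_fiber_poly: "coeff (fiber_poly q z) i = poly (coeff q i) z"
  by (simp add: fiber_poly_def coeff_map_poly)

lemma degree_fiber_poly: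
  assumes "poly (lead_coeff q) z \<noteq> 0"
  shows "degree (fiber_poly q z) = degree q"
proof (rule antisym)
  show "degree (fiber_poly q z) \<le> degree q"
    by (rule degree_le) (simp add: coeff_fiber_poly coeff_eq_0)
  show "degree q \<le> degree (fiber_poly q z)"
    using assms by (intro le_degree) (simp add: coeff_fiber_poly)
qed

lemma fiber_iterate_eq:
  "fiber_iterate p q n z w = poly (orbit_poly (\<lambda>j. fiber_poly q ((poly p ^^ j) z)) n) w"
proof -
  have "(skew_product p q ^^ n) (z, w) =
      ((poly p ^^ n) z, poly (orbit_poly (\<lambda>j. fiber_poly q ((poly p ^^ j) z)) n) w)"
    by (induction n) (simp_all add: skew_product_def poly_pcompose)
  then show ?thesis by (simp add: fiber_iterate_def)
qed

lemma exists_base_polynomial: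
  assumes "degree p \<ge> 2"
  shows "\<exists>C. base_polynomial p C"
proof -
  define s where "s = (\<Sum>i\<le>degree p. norm (coeff p i))"
  define C where "C = 1 + \<bar>ln (norm (lead_coeff p))\<bar> + s"
  have s: "s \<ge> 0" unfolding s_def by (intro sum_nonneg) auto
  have p: "p \<noteq> 0" using assms by auto
  have "base_polynomial p C"
    unfolding base_polynomial_def
  proof
    show "C \<ge> 1" using s by (simp add: C_def)
    have "s \<le> C" by (simp add: C_def)
    also have "C \<le> exp C" using exp_ge_add_one_self[of C] by linarith
    finally show "(\<Sum>i\<le>degree p. norm (coeff p i)) \<le> exp C" by (simp add: s_def)
    show "exp (- (C * 2 ^ i * (3/2) ^ k)) \<le> norm (lead_coeff p)" for i k
    proof -
      have "C * 1 * 1 \<le> C * 2 ^ i * (3/2) ^ k"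
        using \<open>C \<ge> 1\<close> by (intro mult_mono) auto
      moreover have "- C \<le> ln (norm (lead_coeff p))"
        using s unfolding C_def by linarith
      ultimately have "- (C * 2 ^ i * (3/2) ^ k) \<le> ln (norm (lead_coeff p))"
        by linarith
      then show ?thesis using p by (simp add: ln_ge_iff)
    qed
  qed (use assms in auto)
  then show ?thesis by blast
qed

locale skew_polynomial = base_polynomial p C for p C +
  fixes q :: "complex poly poly"
  assumes degree_q: "degree q \<ge> 2"
begin

definition fiber_seq :: "complex \<Rightarrow> nat \<Rightarrow> complex poly" where
  "fiber_seq z j = fiber_poly q ((poly p ^^ j) z)"

abbreviation "b \<equiv> lead_coeff q"

lemma b_nonzero: "b \<noteq> 0"
  using degree_q by auto

lemma fiber_coeff_bound:
  "\<exists>B\<ge>1. \<forall>z\<in>K. (\<Sum>i\<le>degree q. norm (coeff (fiber_poly q z) i)) \<le> exp B"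
proof -
  have "continuous_on K (\<lambda>z. \<Sum>i\<le>degree q. norm (poly (coeff q i) z))"
    by (intro continuous_intros)
  then obtain y where y: "\<forall>z\<in>K. (\<Sum>i\<le>degree q. norm (poly (coeff q i) z)) \<le> (\<Sum>i\<le>degree q. norm (poly (coeff q i) y))"
    using continuous_attains_sup[OF compact_K K_nonempty] by blast
  define B where "B = max 1 (\<Sum>i\<le>degree q. norm (poly (coeff q i) y))"
  have "(\<Sum>i\<le>degree q. norm (coeff (fiber_poly q z) i)) \<le> exp B" if "z \<in> K" for z
  proof -
    have "(\<Sum>i\<le>degree q. norm (poly (coeff q i) z)) \<le> B"
      using y that by (auto simp: B_def intro: order_trans[OF _ max.cobounded2])
    also have "B \<le> exp B" using exp_ge_add_one_self[of B] by linarith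
    finally show ?thesis by (simp add: coeff_fiber_poly)
  qed
  moreover have "B \<ge> 1" by (simp add: B_def)
  ultimately show ?thesis by blast
qed

lemma lead_coeff_fiber_seq:
  assumes "poly b (poly (Q j) z) \<noteq> 0"
  shows "degree (fiber_seq z j) = degree q"
    and "lead_coeff (fiber_seq z j) = poly b (poly (Q j) z)"
  using degree_fiber_poly[of q "poly (Q j) z"] assms
  by (simp_all add: fiber_seq_def poly_Q[symmetric] coeff_fiber_poly)

lemma tempered_fiber_seq:
  assumes "z \<in> K" and c: "\<And>j. exp (- (c * (3/2) ^ j)) \<le> norm (poly b (poly (Q j) z))"
  shows "\<exists>c'. tempered_sequence (fiber_seq z) (degree q) c'"
proof -
  obtain B where B: "B \<ge> 1" "\<And>z. z \<in> K \<Longrightarrow> (\<Sum>i\<le>degree q. norm (coeff (fiber_poly q z) i)) \<le> exp B"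
    using fiber_coeff_bound by blast
  have nz: "poly b (poly (Q j) z) \<noteq> 0" for j
    using c[of j] by auto
  have "tempered_sequence (fiber_seq z) (degree q) (max B c)"
  proof
    show "(\<Sum>i\<le>degree q. norm (coeff (fiber_seq z n) i)) \<le> exp (max B c)" for n
      using B(2)[OF Q_mem_K[OF assms(1), of n]]
      by (simp add: fiber_seq_def poly_Q[symmetric] order_trans[OF _ exp_le_cancel_iff[THEN iffD2]])
    show "exp (- (max B c * (3/2) ^ n)) \<le> norm (lead_coeff (fiber_seq z n))" for n
    proof -
      have "exp (- (max B c * (3/2) ^ n)) \<le> exp (- (c * (3/2) ^ n))"
        by (simp add: mult_right_mono)
      then show ?thesis using c[of n] unfolding lead_coeff_fiber_seq(2)[OF nz] by linarith
    qed
  qed (use degree_q B nz lead_coeff_fiber_seq(1) in \<open>auto simp: le_max_iff_disj\<close>)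
  then show ?thesis by blast
qed

lemma sparse_fiber_seq:
  assumes "z \<in> K"
    and c: "\<And>i k. exp (- (c * 2 ^ i * (3/2) ^ k)) \<le> norm (poly b (poly (Q (i * 2 ^ i + k)) z))"
  shows "\<exists>c0. \<forall>c'\<ge>c0. sparse_sequence (fiber_seq z) (degree q) c'"
proof -
  obtain B where B: "B \<ge> 1" "\<And>z. z \<in> K \<Longrightarrow> (\<Sum>i\<le>degree q. norm (coeff (fiber_poly q z) i)) \<le> exp B"
    using fiber_coeff_bound by blast
  have nz: "poly b (poly (Q j) z) \<noteq> 0" for j
    using c[of 0 j] by auto
  have "sparse_sequence (fiber_seq z) (degree q) c'" if c': "c' \<ge> max B c" for c'
  proof
    show "(\<Sum>i\<le>degree q. norm (coeff (fiber_seq z n) i)) \<le> exp c'" for n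
    proof -
      have "(\<Sum>i\<le>degree q. norm (coeff (fiber_seq z n) i)) \<le> exp B"
        using B(2)[OF Q_mem_K[OF assms(1), of n]] by (simp add: fiber_seq_def poly_Q[symmetric])
      also have "exp B \<le> exp c'" using c' by simp
      finally show ?thesis .
    qed
    show "exp (- (c' * 2 ^ i * (3/2) ^ k)) \<le> norm (lead_coeff (fiber_seq z (i * 2 ^ i + k)))" for i k
    proof -
      have "c * 2 ^ i * (3/2) ^ k \<le> c' * 2 ^ i * (3/2) ^ k"
        using c' by (intro mult_right_mono) auto
      then have "exp (- (c' * 2 ^ i * (3/2) ^ k)) \<le> exp (- (c * 2 ^ i * (3/2) ^ k))"
        by simp
      then show ?thesis using c[of i k] unfolding lead_coeff_fiber_seq(2)[OF nz] by linarith
    qed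
  qed (use degree_q B c' nz lead_coeff_fiber_seq(1) in auto)
  then show ?thesis by blast
qed

lemma fiber_filled_Julia_eq:
  assumes "tempered_sequence (fiber_seq z) (degree q) c"
  shows "fiber_filled_Julia p q z = null_Green_set (fiber_seq z) (degree q)"
proof -
  interpret F: tempered_sequence "fiber_seq z" "degree q" c by fact
  show ?thesis
    unfolding fiber_filled_Julia_def fiber_Green_def fiber_iterate_eq fiber_seq_def[symmetric]
    by (simp add: F.lim_Green_eq_0_iff)
qed

text \<open>
  One product of tame polynomials encodes all requirements: \<open>b\<close> along the orbits of \<open>z\<close> and of \<open>c z + e\<close>, the
  exceptional set \<open>X\<close>, and the forward orbits of the zeros of \<open>b\<close>.  A lower bound for the product bounds each
  factor below, since the remaining ones are bounded above on \<open>K\<close>.  Only the zeros in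
  \<open>K\<close> enter the product, because the orbits of the others never meet \<open>K\<close>.
\<close>

lemma exists_generic_point:
  assumes "norm c = 1" "\<And>z. z \<in> K \<Longrightarrow> c * z + e \<in> K" "finite X"
  shows "\<exists>z\<in>frontier K. z \<notin> X \<and> (\<forall>n \<beta>. poly b \<beta> = 0 \<longrightarrow> poly (Q n) \<beta> \<noteq> z) \<and>
    (\<exists>a. \<forall>i k. exp (- (a * 2 ^ i * (3/2) ^ k)) \<le> norm (poly b (poly (Q (i * 2 ^ i + k)) z)) \<and>
       exp (- (a * 2 ^ i * (3/2) ^ k)) \<le> norm (poly b (poly (Q (i * 2 ^ i + k)) (c * z + e))))"
proof -
  define Z where "Z = {\<beta> \<in> K. poly b \<beta> = 0}"
  have finZ: "finite Z" unfolding Z_def using poly_roots_finite[OF b_nonzero] by (rule rev_finite_subset) auto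
  define P1 where "P1 n = pcompose b (pcompose (Q n) [:0, 1:])" for n
  define P2 where "P2 n = pcompose b (pcompose (Q n) [:e, c:])" for n
  define P3 where "P3 n = (\<Prod>\<beta>\<in>Z. [:- poly (Q n) \<beta>, 1:])" for n
  define P4 where "P4 = (\<Prod>x\<in>X \<inter> K. [:- x, 1:])"
  obtain D1 where D1: "\<And>n. tame D1 (P1 n)"
    using tame_pcompose_orbit[OF b_nonzero, of 1 0] unfolding P1_def by auto
  obtain D2 where D2: "\<And>n. tame D2 (P2 n)"
    using tame_pcompose_orbit[OF b_nonzero assms(1,2)] unfolding P2_def by auto
  define E where "E = max \<kappa>_lim (Rad + Rad)"
  have "Rad + Rad \<le> E" by (simp add: E_def)
  then have "Rad + Rad < exp E"
    using exp_ge_add_one_self[of E] by linarith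
  then have lin: "tame E [:- x, 1:]" if "x \<in> K" for x
    using norm_Q_le_Rad[OF that, of 0] by (intro tame_linear[of x Rad]) (auto simp: E_def)
  have D3: "tame (1 + card Z * E) (P3 n)" for n
    unfolding P3_def using finZ by (intro tame_prod lin Q_mem_K) (auto simp: Z_def)
  have D4: "tame (1 + card (X \<inter> K) * E) P4"
    unfolding P4_def using assms(3) by (intro tame_prod lin) auto
  define D where "D = (1 + card Z * E) + (1 + card (X \<inter> K) * E)"
  have D34: "tame D (P3 n * P4)" for n
    unfolding D_def by (rule tame_mult[OF D3 D4])
  define P where "P n = P1 n * P2 n * (P3 n * P4)" for n
  have "tame (D1 + D2 + D) (P n)" for n
    unfolding P_def by (intro tame_mult D1 D2 D34)
  from generic_point_sparse[of "D1 + D2 + D" P, OF this] obtain z a where z: "z \<in> frontier K" "a \<ge> 0"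
    and ge: "\<And>i k. exp (- (a * 2 ^ i * (3/2) ^ k)) \<le>
        norm (poly (P1 (i * 2 ^ i + k) * P2 (i * 2 ^ i + k) * (P3 (i * 2 ^ i + k) * P4)) z)"
    unfolding P_def by blast
  have zK: "z \<in> K" using z(1) frontier_K_subset by blast
  have factor: "exp (- ((a + \<bar>D'\<bar>) * 2 ^ i * (3/2) ^ k)) \<le> norm u"
    if "exp (- (a * 2 ^ i * (3/2) ^ k)) \<le> norm (u * v)" "norm v < exp D'"
    for u v :: complex and D' i k
  proof -
    define s where "s = 2 ^ i * (3/2::real) ^ k"
    have "1 * 1 \<le> s" unfolding s_def by (intro mult_mono) auto
    then have "\<bar>D'\<bar> * 1 \<le> \<bar>D'\<bar> * s" by (intro mult_left_mono) auto
    then have "- ((a + \<bar>D'\<bar>) * s) + D' \<le> - (a * s)" by (simp add: distrib_right)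
    then have "exp (- ((a + \<bar>D'\<bar>) * s)) * exp D' \<le> exp (- (a * s))"
      by (simp add: exp_add[symmetric])
    also have "\<dots> \<le> norm u * norm v" using that(1) by (simp add: norm_mult s_def mult_ac)
    also have "\<dots> \<le> norm u * exp D'" using that(2) by (intro mult_left_mono) auto
    finally show ?thesis by (simp add: s_def mult_ac)
  qed
  define a' where "a' = a + \<bar>D2 + D\<bar> + \<bar>D1 + D\<bar>"
  have mono: "exp (- (a' * 2 ^ i * (3/2) ^ k)) \<le> exp (- (x * 2 ^ i * (3/2) ^ k))" if "x \<le> a'" for x i k
    using that by (simp add: mult_right_mono)
  have "exp (- (a' * 2 ^ i * (3/2) ^ k)) \<le> norm (poly b (poly (Q (i * 2 ^ i + k)) z))" for i k
  proof -
    define n where "n = i * 2 ^ i + k"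
    have "tame (D2 + D) (P2 n * (P3 n * P4))" by (intro tame_mult D2 D34)
    then have "norm (poly (P2 n * (P3 n * P4)) z) < exp (D2 + D)" using zK by (simp add: tame_def)
    moreover have "exp (- (a * 2 ^ i * (3/2) ^ k)) \<le> norm (poly (P1 n) z * poly (P2 n * (P3 n * P4)) z)"
      using ge[of i k] by (simp add: n_def mult.assoc)
    ultimately have "exp (- ((a + \<bar>D2 + D\<bar>) * 2 ^ i * (3/2) ^ k)) \<le> norm (poly (P1 n) z)"
      by (intro factor)
    moreover have "poly (P1 n) z = poly b (poly (Q n) z)"
      by (simp add: P1_def poly_pcompose)
    moreover have "a + \<bar>D2 + D\<bar> \<le> a'" by (simp add: a'_def)
    then have "exp (- (a' * 2 ^ i * (3/2) ^ k)) \<le> exp (- ((a + \<bar>D2 + D\<bar>) * 2 ^ i * (3/2) ^ k))"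
      by (rule mono)
    ultimately show ?thesis unfolding n_def by (simp only: order_trans)
  qed
  moreover have "exp (- (a' * 2 ^ i * (3/2) ^ k)) \<le> norm (poly b (poly (Q (i * 2 ^ i + k)) (c * z + e)))" for i k
  proof -
    define n where "n = i * 2 ^ i + k"
    have "tame (D1 + D) (P1 n * (P3 n * P4))" by (intro tame_mult D1 D34)
    then have "norm (poly (P1 n * (P3 n * P4)) z) < exp (D1 + D)" using zK by (simp add: tame_def)
    moreover have "exp (- (a * 2 ^ i * (3/2) ^ k)) \<le> norm (poly (P2 n) z * poly (P1 n * (P3 n * P4)) z)"
      using ge[of i k] by (simp add: n_def mult_ac)
    ultimately have "exp (- ((a + \<bar>D1 + D\<bar>) * 2 ^ i * (3/2) ^ k)) \<le> norm (poly (P2 n) z)"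
      by (intro factor)
    moreover have "poly (P2 n) z = poly b (poly (Q n) (c * z + e))"
      by (simp add: P2_def poly_pcompose add.commute mult.commute)
    moreover have "a + \<bar>D1 + D\<bar> \<le> a'" by (simp add: a'_def)
    then have "exp (- (a' * 2 ^ i * (3/2) ^ k)) \<le> exp (- ((a + \<bar>D1 + D\<bar>) * 2 ^ i * (3/2) ^ k))"
      by (rule mono)
    ultimately show ?thesis unfolding n_def by (simp only: order_trans)
  qed
  moreover have nz: "poly (P3 n) z \<noteq> 0" "poly P4 z \<noteq> 0" for n
    using ge[of 0 n] by (auto simp: not_le)
  have "z \<notin> X"
  proof
    assume "z \<in> X"
    then have "poly P4 z = 0" unfolding P4_def poly_prod using assms(3) zK
      by (intro prod_zero) auto
    then show False using nz by simp
  qed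
  moreover have "poly (Q n) \<beta> \<noteq> z" if "poly b \<beta> = 0" for n \<beta>
  proof
    assume eq: "poly (Q n) \<beta> = z"
    then have "\<beta> \<in> Z" using zK Q_mem_K_iff[of n \<beta>] that by (simp add: Z_def)
    then have "poly (P3 n) z = 0" unfolding P3_def poly_prod using finZ eq
      by (intro prod_zero) auto
    then show False using nz by simp
  qed
  ultimately show ?thesis using z(1) by blast
qed

lemma Q_mem_frontier_imp:
  assumes "poly (Q n) z \<in> frontier K"
  shows "z \<in> frontier K"
proof -
  have "z \<in> K"
    using assms frontier_K_subset Q_mem_K_iff[of n z] by blast
  moreover have "z \<notin> interior K"
  proof
    assume z: "z \<in> interior K"
    have "\<not> poly (Q n) constant_on UNIV"
    proof
      assume "poly (Q n) constant_on UNIV"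
      then have "constant (poly (Q n))"
        unfolding constant_on_def Fundamental_Theorem_Algebra.constant_def by (metis UNIV_I)
      then show False using degree_Q_pos[of n] by (simp add: constant_degree)
    qed
    then have "open (poly (Q n) ` interior K)"
      using open_mapping_thm[OF holomorphic_on_poly[of "Q n" UNIV], of "interior K"] by auto
    moreover have "poly (Q n) ` interior K \<subseteq> K"
      using Q_mem_K interior_subset by blast
    ultimately have "poly (Q n) z \<in> interior K"
      using z by (meson imageI interior_maximal subsetD)
    then show False using assms by (simp add: frontier_def)
  qed
  ultimately show ?thesis
    unfolding frontier_def using closure_subset by blast
qed

text \<open>
  Montel's argument.  If all iterates omitted \<open>a\<close> and \<open>a'\<close> near \<open>z0\<close>, then, being bounded at \<open>z0\<close> itself, they
  would be uniformly bounded on a neighbourhood of \<open>z0\<close>, which would then lie inside \<open>K\<close>.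
\<close>

lemma exists_preimage_near_frontier:
  assumes "z0 \<in> frontier K" "\<epsilon> > 0" "a \<noteq> a'"
  shows "\<exists>n y. y \<in> ball z0 \<epsilon> \<and> poly (Q n) y \<in> {a, a'}"
proof (rule ccontr)
  assume neg: "\<not> ?thesis"
  define h where "h n = (\<lambda>y. (poly (Q n) y - a) / (a' - a))" for n
  have z0K: "z0 \<in> K" using assms(1) frontier_K_subset by blast
  define r where "r = 1 + (Rad + norm a) / norm (a' - a)"
  have r: "r > 0" using Rad_gt_1 unfolding r_def by (intro add_pos_nonneg divide_nonneg_nonneg) auto
  obtain B Z where BZ: "open Z" "z0 \<in> Z" "\<And>g z. g \<in> range h \<Longrightarrow> z \<in> Z \<Longrightarrow> norm (g z) \<le> B"
  proof (rule GPicard1[of "ball z0 \<epsilon>" z0 r "range h" "range h"])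
    show "g holomorphic_on ball z0 \<epsilon>" if "g \<in> range h" for g
      using that assms(3) by (auto simp: h_def intro!: holomorphic_intros holomorphic_on_poly)
    show "g z \<noteq> 0 \<and> g z \<noteq> 1" if "g \<in> range h" "z \<in> ball z0 \<epsilon>" for g z
      using that neg assms(3) by (auto simp: h_def)
    show "norm (g z0) \<le> r" if g: "g \<in> range h" for g
    proof -
      obtain n where n: "g = h n" using g by blast
      have "norm (poly (Q n) z0 - a) \<le> Rad + norm a"
        using norm_Q_le_Rad[OF z0K, of n] norm_triangle_ineq4[of "poly (Q n) z0" a] by linarith
      then have "norm (poly (Q n) z0 - a) / norm (a' - a) \<le> (Rad + norm a) / norm (a' - a)"
        by (intro divide_right_mono) auto
      then show ?thesis by (simp add: n h_def r_def norm_divide)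
    qed
  qed (use r assms(2) in auto)
  have "Z \<subseteq> K"
  proof
    fix y assume y: "y \<in> Z"
    have "norm (poly (Q n) y) \<le> B * norm (a' - a) + norm a" for n
    proof -
      have "norm (h n y) \<le> B" using BZ(3) y by blast
      then have "norm (poly (Q n) y - a) \<le> B * norm (a' - a)"
        using assms(3) by (simp add: h_def norm_divide field_simps)
      then show ?thesis using norm_triangle_ineq2[of "poly (Q n) y" a] by linarith
    qed
    then show "y \<in> K" by (rule mem_K_of_bounded)
  qed
  then have "z0 \<in> interior K" using BZ(1,2) by (meson interior_maximal subsetD)
  then show False using assms(1) by (simp add: frontier_def)
qed

text \<open>
  Near \<open>z0\<close> there is an iterated preimage \<open>y\<close> of one of two generic points \<open>t1\<close>, \<open>t2\<close>.  Its orbit inherits the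
  lower bounds on \<open>b\<close> from the generic point except for finitely many times, and at those times \<open>b\<close> does not
  vanish because the generic point is not on the forward orbit of a zero of \<open>b\<close>.
\<close>

lemma frontier_K_subset_closure_nonempty_fibers:
  "frontier K \<subseteq> closure {z \<in> frontier K. frontier (fiber_filled_Julia p q z) \<noteq> {}}" (is "_ \<subseteq> closure ?A")
proof
  fix z0 assume z0: "z0 \<in> frontier K"
  define good where "good t \<longleftrightarrow> t \<in> frontier K \<and> (\<forall>n \<beta>. poly b \<beta> = 0 \<longrightarrow> poly (Q n) \<beta> \<noteq> t) \<and>
     (\<exists>a. \<forall>k. exp (- (a * (3/2) ^ k)) \<le> norm (poly b (poly (Q k) t)))" for t
  have ex: "\<exists>t. good t \<and> t \<notin> X" if X: "finite X" for X
  proof -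
    obtain t a where t: "t \<in> frontier K" "t \<notin> X" "\<forall>n \<beta>. poly b \<beta> = 0 \<longrightarrow> poly (Q n) \<beta> \<noteq> t"
      "\<And>i k. exp (- (a * 2 ^ i * (3/2) ^ k)) \<le> norm (poly b (poly (Q (i * 2 ^ i + k)) t))"
      using exists_generic_point[of 1 0, OF _ _ X] by fastforce
    have "exp (- (a * (3/2) ^ k)) \<le> norm (poly b (poly (Q k) t))" for k
      using t(4)[of 0 k] by simp
    then have "good t" using t(1,3) unfolding good_def by blast
    then show ?thesis using t(2) by blast
  qed
  obtain t1 where t1: "good t1" using ex[of "{}"] by auto
  obtain t2 where t2: "good t2" "t1 \<noteq> t2" using ex[of "{t1}"] by auto
  show "z0 \<in> closure ?A"
    unfolding closure_approachable
  proof (intro allI impI)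
    fix \<epsilon> :: real assume "\<epsilon> > 0"
    from exists_preimage_near_frontier[OF z0 this t2(2)]
    obtain n y where y: "y \<in> ball z0 \<epsilon>" "good (poly (Q n) y)" using t1 t2(1) by auto
    define t where "t = poly (Q n) y"
    have t: "t \<in> frontier K" "\<And>m \<beta>. poly b \<beta> = 0 \<Longrightarrow> poly (Q m) \<beta> \<noteq> t"
      using y(2) unfolding good_def t_def by blast+
    obtain a where a: "\<And>k. exp (- (a * (3/2) ^ k)) \<le> norm (poly b (poly (Q k) t))"
      using y(2) unfolding good_def t_def by blast
    have yJ: "y \<in> frontier K"
      using t(1) unfolding t_def by (rule Q_mem_frontier_imp)
    have add: "poly (Q (i + j)) x = poly (Q j) (poly (Q i) x)" for i j x
      using orbit_poly_add[of "\<lambda>_. p" i j] by (simp add: poly_pcompose)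
    define a' where "a' = \<bar>a\<bar> + (\<Sum>j<n. \<bar>ln (norm (poly b (poly (Q j) y)))\<bar>)"
    have S0: "(\<Sum>j<n. \<bar>ln (norm (poly b (poly (Q j) y)))\<bar>) \<ge> 0" by (intro sum_nonneg) auto
    have "exp (- (a' * (3/2) ^ j)) \<le> norm (poly b (poly (Q j) y))" for j
    proof (cases "j < n")
      case True
      have nz: "poly b (poly (Q j) y) \<noteq> 0"
        using t(2)[of "poly (Q j) y" "n - j"] add[of j "n - j" y] True by (auto simp: t_def)
      have "\<bar>ln (norm (poly b (poly (Q j) y)))\<bar> \<le> (\<Sum>j<n. \<bar>ln (norm (poly b (poly (Q j) y)))\<bar>)"
        using True by (intro member_le_sum) auto
      then have "\<bar>ln (norm (poly b (poly (Q j) y)))\<bar> \<le> a'" by (simp add: a'_def)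
      moreover have "a' * 1 \<le> a' * (3/2) ^ j"
        using S0 by (intro mult_left_mono) (auto simp: a'_def)
      ultimately have "- (a' * (3/2) ^ j) \<le> ln (norm (poly b (poly (Q j) y)))" by linarith
      then show ?thesis using nz by (simp add: ln_ge_iff)
    next
      case False
      have "a * (3/2) ^ (j - n) \<le> a' * (3/2) ^ j"
      proof (intro mult_mono power_increasing)
        show "a \<le> a'" using S0 abs_ge_self[of a] unfolding a'_def by linarith
        show "0 \<le> a'" using S0 unfolding a'_def by linarith
      qed auto
      then have "exp (- (a' * (3/2) ^ j)) \<le> exp (- (a * (3/2) ^ (j - n)))" by simp
      also have "\<dots> \<le> norm (poly b (poly (Q (j - n)) t))" by (rule a)
      also have "poly (Q (j - n)) t = poly (Q j) y"
        using add[of n "j - n" y] False by (simp add: t_def)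
      finally show ?thesis .
    qed
    then obtain c where c: "tempered_sequence (fiber_seq y) (degree q) c"
      using tempered_fiber_seq[of y a'] yJ frontier_K_subset by blast
    have "frontier (fiber_filled_Julia p q y) \<noteq> {}"
      unfolding fiber_filled_Julia_eq[OF c] by (rule tempered_sequence.frontier_K_nonempty[OF c])
    then show "\<exists>x\<in>?A. dist x z0 < \<epsilon>"
      using yJ y(1) by (auto simp: dist_commute)
  qed
qed

text \<open>
  The polynomials \<open>Q n\<close> composed with the affine map are bounded by \<open>Rad\<close> on the frontier, hence on \<open>K\<close>.
\<close>

lemma isometry_maps_K_to_K:
  assumes "(\<lambda>z. c * z + e) ` frontier K \<subseteq> frontier K" "z \<in> K"
  shows "c * z + e \<in> K"
proof (rule mem_K_of_bounded)
  fix n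
  have "norm (poly (pcompose (Q n) [:e, c:]) z) \<le> Rad"
  proof (rule norm_poly_le_of_frontier[OF compact_K _ assms(2)])
    fix w assume "w \<in> frontier K"
    then have "c * w + e \<in> K" using assms(1) frontier_K_subset by blast
    then show "norm (poly (pcompose (Q n) [:e, c:]) w) \<le> Rad"
      using norm_Q_le_Rad[of "c * w + e" n] by (simp add: poly_pcompose add.commute mult.commute)
  qed
  then show "norm (poly (Q n) (c * z + e)) \<le> Rad"
    by (simp add: poly_pcompose add.commute mult.commute)
qed

end

section \<open>Symmetries of the Julia set\<close>

lemma affine_image_subset_of_dense:
  fixes A J :: "complex set"
  assumes "closed J" "A \<subseteq> J" "J \<subseteq> closure A" "(\<lambda>z. c * z + e) ` A \<subseteq> A"
  shows "(\<lambda>z. c * z + e) ` J \<subseteq> J"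
proof -
  have "(\<lambda>z. c * z + e) ` closure A \<subseteq> J"
    using assms by (intro image_closure_subset continuous_intros) auto
  then show ?thesis using assms(3) by blast
qed

lemma image_eq_of_dense_invariant:
  fixes A J :: "complex set"
  assumes "closed J" "A \<subseteq> J" "J \<subseteq> closure A" "(\<lambda>z. c * z + e) ` A = A" "c \<noteq> 0"
  shows "(\<lambda>z. c * z + e) ` J = J"
proof
  show "(\<lambda>z. c * z + e) ` J \<subseteq> J"
    using affine_image_subset_of_dense[OF assms(1-3), of c e] assms(4) by simp
  have inv: "(1 / c) * (c * z + e) + (- e / c) = z" for z
    using assms(5) by (simp add: field_simps)
  have "(\<lambda>z. (1 / c) * z + (- e / c)) ` A = (\<lambda>z. (1 / c) * z + (- e / c)) ` (\<lambda>z. c * z + e) ` A"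
    by (simp only: assms(4))
  also have "\<dots> = A" by (simp only: image_image inv image_ident)
  finally have "(\<lambda>z. (1 / c) * z + (- e / c)) ` J \<subseteq> J"
    using affine_image_subset_of_dense[OF assms(1-3), of "1 / c" "- e / c"] by simp
  moreover have "z = c * ((1 / c) * z + (- e / c)) + e" for z
    using assms(5) by (simp add: field_simps)
  ultimately show "J \<subseteq> (\<lambda>z. c * z + e) ` J" by blast
qed

context skew_polynomial
begin

lemma mem_skew_Julia_iff:
  "(z, w) \<in> skew_Julia p q \<longleftrightarrow> z \<in> frontier K \<and> w \<in> frontier (fiber_filled_Julia p q z)"
  by (auto simp: skew_Julia_def base_Julia_eq)

context
  fixes \<gamma> :: "complex \<times> complex \<Rightarrow> complex \<times> complex" and c1 c2 c3 :: complex and c4 :: "complex poly"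
  assumes \<gamma>: "\<gamma> = (\<lambda>(z, w). (c1 * z + c2, c3 * w + poly c4 z))"
    and c1: "norm c1 = 1" and c3: "norm c3 = 1"
    and invariant: "\<gamma> ` skew_Julia p q = skew_Julia p q"
begin

lemma base_Julia_invariant: "(\<lambda>z. c1 * z + c2) ` frontier K = frontier K"
proof (rule image_eq_of_dense_invariant)
  let ?A = "{z \<in> frontier K. frontier (fiber_filled_Julia p q z) \<noteq> {}}"
  have A: "?A = fst ` skew_Julia p q"
    using mem_skew_Julia_iff by force
  have "fst ` \<gamma> ` skew_Julia p q = (\<lambda>z. c1 * z + c2) ` fst ` skew_Julia p q"
    by (simp add: image_image \<gamma> case_prod_unfold)
  then show "(\<lambda>z. c1 * z + c2) ` ?A = ?A"
    unfolding A invariant by simp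
  show "frontier K \<subseteq> closure ?A"
    by (rule frontier_K_subset_closure_nonempty_fibers)
qed (use c1 in auto)

lemma fiber_frontier_image:
  assumes "z \<in> frontier K"
  shows "frontier (fiber_filled_Julia p q (c1 * z + c2)) =
    (\<lambda>w. c3 * w + poly c4 z) ` frontier (fiber_filled_Julia p q z)"
proof (intro set_eqI iffI)
  fix w' assume w': "w' \<in> frontier (fiber_filled_Julia p q (c1 * z + c2))"
  have "c1 * z + c2 \<in> frontier K" using assms base_Julia_invariant by blast
  then have "(c1 * z + c2, w') \<in> \<gamma> ` skew_Julia p q"
    using w' mem_skew_Julia_iff invariant by blast
  then obtain y w where "(y, w) \<in> skew_Julia p q" "c1 * y + c2 = c1 * z + c2" "w' = c3 * w + poly c4 y"
    by (auto simp: \<gamma>)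
  moreover have "c1 \<noteq> 0" using c1 by auto
  ultimately show "w' \<in> (\<lambda>w. c3 * w + poly c4 z) ` frontier (fiber_filled_Julia p q z)"
    by (auto simp: mem_skew_Julia_iff)
next
  fix w' assume "w' \<in> (\<lambda>w. c3 * w + poly c4 z) ` frontier (fiber_filled_Julia p q z)"
  then obtain w where w: "w \<in> frontier (fiber_filled_Julia p q z)" "w' = c3 * w + poly c4 z" by blast
  then have "\<gamma> (z, w) \<in> skew_Julia p q"
    using assms invariant mem_skew_Julia_iff by blast
  then show "w' \<in> frontier (fiber_filled_Julia p q (c1 * z + c2))"
    by (simp add: \<gamma> w(2) mem_skew_Julia_iff)
qed

lemma base_centroid_fixed: "c1 * base_centroid p + c2 = base_centroid p"
proof -
  have "c1 * centroid p + c2 = centroid p"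
    using centroid_of_frontier_symmetry[OF sparse_sequence_axioms sparse_sequence_axioms c1]
      base_Julia_invariant by simp
  then show ?thesis by (simp add: base_centroid_def centroid_def)
qed

text \<open>
  A finite set of solutions could be handed to \<open>exists_generic_point\<close> as exceptional set, and the generic point
  outside it would be one more solution.
\<close>

lemma infinite_centroid_relation:
  "infinite {z. poly b z \<noteq> 0 \<and> poly b (c1 * z + c2) \<noteq> 0 \<and>
     c3 * centroid (fiber_poly q z) + poly c4 z = centroid (fiber_poly q (c1 * z + c2))}"
    (is "infinite ?S")
proof
  assume fin: "finite ?S"
  have K: "c1 * z + c2 \<in> K" if "z \<in> K" for z
    using isometry_maps_K_to_K[OF _ that] base_Julia_invariant by simp
  obtain z a where z: "z \<in> frontier K" "z \<notin> ?S"
    and a: "\<And>i k. exp (- (a * 2 ^ i * (3/2) ^ k)) \<le> norm (poly b (poly (Q (i * 2 ^ i + k)) z))"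
      "\<And>i k. exp (- (a * 2 ^ i * (3/2) ^ k)) \<le> norm (poly b (poly (Q (i * 2 ^ i + k)) (c1 * z + c2)))"
    using exists_generic_point[OF c1 K fin] by blast
  let ?z' = "c1 * z + c2"
  have zK: "z \<in> K" "?z' \<in> K" using z(1) frontier_K_subset K by blast+
  obtain C1 C2 where C: "\<And>c. c \<ge> C1 \<Longrightarrow> sparse_sequence (fiber_seq z) (degree q) c"
    "\<And>c. c \<ge> C2 \<Longrightarrow> sparse_sequence (fiber_seq ?z') (degree q) c"
    using sparse_fiber_seq[OF zK(1) a(1)] sparse_fiber_seq[OF zK(2) a(2)] by blast
  define c where "c = max C1 C2"
  have S: "sparse_sequence (fiber_seq z) (degree q) c" "sparse_sequence (fiber_seq ?z') (degree q) c"
    using C by (simp_all add: c_def)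
  then have T: "tempered_sequence (fiber_seq z) (degree q) c" "tempered_sequence (fiber_seq ?z') (degree q) c"
    using sparse_sequence.tempered_shift[of _ _ _ 0] by force+
  have "c3 * centroid (fiber_seq z 0) + poly c4 z = centroid (fiber_seq ?z' 0)"
    using fiber_frontier_image[OF z(1)]
    by (intro centroid_of_frontier_symmetry[OF S c3]) (simp add: fiber_filled_Julia_eq[OF T(1)] fiber_filled_Julia_eq[OF T(2)])
  moreover have "poly b z \<noteq> 0" "poly b ?z' \<noteq> 0"
    using a(1)[of 0 0] a(2)[of 0 0] by auto
  ultimately have "z \<in> ?S" by (simp add: fiber_seq_def)
  then show False using z(2) by contradiction
qed

text \<open>
  The relation \<open>c3 \<zeta>\<^sub>z + c4(z) = \<zeta>\<close> at \<open>\<sigma> z\<close> with denominators cleared.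
\<close>

lemma centroid_identity:
  defines "\<sigma> \<equiv> [:c2, c1:]" and "b' \<equiv> coeff q (degree q - 1)" and "n \<equiv> (of_nat (degree q) :: complex poly)"
  shows "c4 * (n * b * pcompose b \<sigma>) = smult c3 b' * pcompose b \<sigma> - pcompose b' \<sigma> * b"
proof -
  define H where "H = c4 * (n * b * pcompose b \<sigma>) - (smult c3 b' * pcompose b \<sigma> - pcompose b' \<sigma> * b)"
  have n: "poly n z = of_nat (degree q)" for z by (simp add: n_def)
  have "{z. poly b z \<noteq> 0 \<and> poly b (c1 * z + c2) \<noteq> 0 \<and>
     c3 * centroid (fiber_poly q z) + poly c4 z = centroid (fiber_poly q (c1 * z + c2))} \<subseteq> {z. poly H z = 0}"
  proof (intro subsetI CollectI; elim CollectE conjE)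
    fix z assume nz: "poly b z \<noteq> 0" "poly b (c1 * z + c2) \<noteq> 0"
      and eq: "c3 * centroid (fiber_poly q z) + poly c4 z = centroid (fiber_poly q (c1 * z + c2))"
    define N where "N = (of_nat (degree q) :: complex)"
    have N: "N \<noteq> 0" using degree_q by (simp add: N_def)
    have cen: "centroid (fiber_poly q y) = - poly b' y / (N * poly b y)" if "poly b y \<noteq> 0" for y
      using degree_fiber_poly[OF that] by (simp add: centroid_def coeff_fiber_poly b'_def N_def)
    have "poly c4 z = c3 * (poly b' z / (N * poly b z)) - poly b' (c1 * z + c2) / (N * poly b (c1 * z + c2))"
      using eq unfolding cen[OF nz(1)] cen[OF nz(2)] by (simp add: algebra_simps)
    then have "poly c4 z * (N * poly b z * poly b (c1 * z + c2)) =
      c3 * poly b' z * poly b (c1 * z + c2) - poly b' (c1 * z + c2) * poly b z"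
      using N nz by (simp add: field_simps)
    then show "poly H z = 0"
      by (simp add: H_def n N_def[symmetric] \<sigma>_def poly_pcompose algebra_simps)
  qed
  then have "infinite {z. poly H z = 0}"
    using infinite_centroid_relation infinite_super by blast
  then have "H = 0" using poly_roots_finite by blast
  then show ?thesis by (simp add: H_def)
qed

lemma fract_centroid_identity:
  "to_fract [:c4, [:c3:]:] =
     ratfun_const c3 * (ratfun_w - fiber_centroid q [:0, 1:]) + fiber_centroid q [:c2, c1:]"
proof -
  define \<sigma> where "\<sigma> = [:c2, c1:]"
  define b' where "b' = coeff q (degree q - 1)"
  define n where "n = (of_nat (degree q) :: complex poly)"
  define T where "T x = to_fract [:x :: complex poly:]" for x
  have T: "T (x * y) = T x * T y" "T (x + y) = T x + T y" "T (x - y) = T x - T y" "T (- x) = - T x" for x y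
    by (simp_all add: T_def flip: to_fract_mult to_fract_add to_fract_diff to_fract_uminus)
  have T0: "T x \<noteq> 0" if "x \<noteq> 0" for x using that by (simp add: T_def)
  have n0: "n \<noteq> 0" using degree_q by (simp add: n_def)
  have "c1 \<noteq> 0" using c1 by auto
  then have bs: "pcompose b \<sigma> \<noteq> 0" using b_nonzero by (auto simp: pcompose_eq_0_iff \<sigma>_def)
  have nz: "T n \<noteq> 0" "T b \<noteq> 0" "T (pcompose b \<sigma>) \<noteq> 0"
    using T0 n0 bs b_nonzero by auto
  have sm: "smult c3 b' = [:c3:] * b'" by simp
  have "T c4 * (T n * T b * T (pcompose b \<sigma>)) =
      T [:c3:] * T b' * T (pcompose b \<sigma>) - T (pcompose b' \<sigma>) * T b"
    using arg_cong[OF centroid_identity, of T]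
    unfolding sm T \<sigma>_def[symmetric] b'_def[symmetric] n_def[symmetric] .
  then have "T c4 = T [:c3:] * (T b' / (T n * T b)) - T (pcompose b' \<sigma>) / (T n * T (pcompose b \<sigma>))"
    using nz by (simp add: field_simps)
  moreover have "fiber_centroid q s = - T (pcompose b' s) / (T n * T (pcompose b s))" for s
    by (simp add: fiber_centroid_def Fract_conv_to_fract T_def b'_def n_def flip: to_fract_uminus to_fract_mult)
  then have "fiber_centroid q [:0, 1:] = - T b' / (T n * T b)"
    and "fiber_centroid q \<sigma> = - T (pcompose b' \<sigma>) / (T n * T (pcompose b \<sigma>))"
    by simp_all
  moreover have "to_fract [:c4, [:c3:]:] = T c4 + ratfun_const c3 * ratfun_w"
    by (simp add: T_def ratfun_const_def ratfun_w_def flip: to_fract_add to_fract_mult)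
  moreover have "ratfun_const c3 = T [:c3:]" by (simp add: T_def ratfun_const_def)
  ultimately show ?thesis unfolding \<sigma>_def[symmetric] by (simp add: algebra_simps)
qed

end

end

theorem proposition4p2:
  fixes p :: "complex poly" and q :: "complex poly poly"
    and \<gamma> :: "complex \<times> complex \<Rightarrow> complex \<times> complex"
  assumes "degree p \<ge> 2" and "degree q \<ge> 2"
    and "\<gamma> \<in> skew_symmetries p q"
  shows "\<exists>\<mu> \<nu> :: complex. \<exists>\<sigma> :: complex poly. norm \<mu> = 1 \<and> norm \<nu> = 1 \<and>
     \<sigma> = smult \<mu> ([:0, 1:] - [:base_centroid p:]) + [:base_centroid p:] \<and>
     poly \<sigma> \<in> base_symmetries p \<and>
     (\<exists>g :: complex poly poly.
        (\<forall>z w. \<gamma> (z, w) = (poly \<sigma> z, poly (fiber_poly g z) w)) \<and>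
        to_fract g =
          ratfun_const \<nu> * (ratfun_w - fiber_centroid q [:0, 1:]) + fiber_centroid q \<sigma>)"
proof -
  obtain c1 c2 c3 c4 where c: "norm c1 = 1" "norm c3 = 1"
    and \<gamma>: "\<gamma> = (\<lambda>(z, w). (c1 * z + c2, c3 * w + poly c4 z))"
    and inv: "\<gamma> ` skew_Julia p q = skew_Julia p q"
    using assms(3) by (auto simp: skew_symmetries_def symmetry_maps_def)
  obtain C where "base_polynomial p C" using exists_base_polynomial[OF assms(1)] by blast
  then interpret skew_polynomial p C q
    using assms(2) by (simp add: skew_polynomial_def skew_polynomial_axioms_def)
  define \<sigma> where "\<sigma> = [:c2, c1:]"
  define g where "g = [:c4, [:c3:]:]"
  have \<sigma>: "poly \<sigma> = (\<lambda>z. c1 * z + c2)" by (auto simp: \<sigma>_def)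
  have "c2 = base_centroid p - c1 * base_centroid p"
    using base_centroid_fixed[OF \<gamma> c inv] by (simp add: algebra_simps)
  then have "\<sigma> = smult c1 ([:0, 1:] - [:base_centroid p:]) + [:base_centroid p:]"
    by (simp add: \<sigma>_def)
  moreover have "poly \<sigma> \<in> base_symmetries p"
    using base_Julia_invariant[OF \<gamma> c inv] c(1) unfolding base_symmetries_def base_Julia_eq \<sigma> by blast
  moreover have "c3 \<noteq> 0" using c(2) by auto
  then have "\<gamma> (z, w) = (poly \<sigma> z, poly (fiber_poly g z) w)" for z w
    by (simp add: \<gamma> \<sigma> g_def fiber_poly_def map_poly_pCons)
  moreover have "to_fract g = ratfun_const c3 * (ratfun_w - fiber_centroid q [:0, 1:]) + fiber_centroid q \<sigma>"
    unfolding g_def \<sigma>_def by (rule fract_centroid_identity[OF \<gamma> c inv])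
  ultimately show ?thesis using c by blast
qed

end
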